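(* Let $\mathscr{C}$ be an extriangulated category with negative first extensions. Then the assignments $$(\mathcal{T},\mathcal{F})\mapsto(\mathrm{Infl}\,\mathcal{T},\mathrm{Infl}\,\mathcal{F})\quad\text{and}\quad(\mathcal{L},\mathcal{R})\mapsto(\mathrm{Cone}(\mathcal{L}),\mathrm{Cone}(\mathcal{R}))$$ give mutually inverse bijections between the following classes: (1) $s$-torsion pairs in $\mathscr{C}$; (2) inflation factorization systems in $\mathscr{C}$.
   Context: All categories are additive; all subcategories are full and closed under isomorphisms. Extriangulated category (Nakaoka–Palu): a triple $(\mathscr{C},\mathbb{E},\mathfrak{s})$ where $\mathscr{C}$ is an additive category, (ET1) $\mathbb{E}:\mathscr{C}^{op}\times\mathscr{C}\to Ab$ is a biadditive functor, and (ET2) $\mathfrak{s}$ is an additive realization of $\mathbb{E}$. For $\delta\in\mathbb{E}(C,A)$, $a:A\to A'$, $c:C'\to C$ write $a_*\delta=\mathbb{E}(C,a)(\delta)$, $c^*\delta=\mathbb{E}(c,A)(\delta)$. A morphism $(a,c):\delta\to\delta'$ from $\delta\in\mathbb{E}(C,A)$ to $\delta'\in\mathbb{E}(C',A')$ is a pair $a:A\to A'$, $c:C\to C'$ with $a_*\delta=c^*\delta'$. A realization $\mathfrak{s}$ assigns to each $\delta\in\mathbb{E}(C,A)$ an equivalence class $[A\xrightarrow{x}B\xrightarrow{y}C]$ (two such sequences are equivalent if there is an isomorphism of middle terms compatible with the identities of $A$ and $C$), such that each morphism $(a,c):\delta\to\delta'$ can be completed by some $b:B\to B'$ to a commutative diagram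 between the realizing sequences; it is additive if $\mathfrak{s}(0)=[A\to A\oplus C\to C]$ (the canonical split sequence) and $\mathfrak{s}(\delta\oplus\delta')=\mathfrak{s}(\delta)\oplus\mathfrak{s}(\delta')$. Moreover: (ET3) if $\mathfrak{s}(\delta)=[A\xrightarrow{x}B\xrightarrow{y}C]$, $\mathfrak{s}(\delta')=[A'\xrightarrow{x'}B'\xrightarrow{y'}C']$ and $bx=x'a$, there is $c:C\to C'$ with $cy=y'b$ and $a_*\delta=c^*\delta'$; (ET4) if $\mathfrak{s}(\delta)=[A\xrightarrow{f}B\xrightarrow{f'}D]$ and $\mathfrak{s}(\delta')=[B\xrightarrow{g}C\xrightarrow{g'}F]$, there are an object $E$, morphisms $h':C\to E$, $d:D\to E$, $e:E\to F$ and $\delta''\in\mathbb{E}(E,A)$ with $h'g=df'$, $eh'=g'$, $\mathfrak{s}(\delta'')=[A\xrightarrow{gf}C\xrightarrow{h'}E]$, $\mathfrak{s}(f'_*\delta')=[D\xrightarrow{d}E\xrightarrow{e}F]$, $d^*\delta''=\delta$, $f_*\delta''=e^*\delta'$; and the duals (ET3)$^{op}$, (ET4)$^{op}$. If $\mathfrak{s}(\delta)=[A\xrightarrow{x}B\xrightarrow{y}C]$, then $A\xrightarrow{x}B\xrightarrow{y}C$ is a conflation, $x$ an inflation, $y$ a deflation, and $A\xrightarrow{x}B\xrightarrow{y}C\overset{\delta}{\dashrightarrow}$ an $\mathbb{E}$-triangle; one writes $C=\mathrm{cone}(x)$, $A=\mathrm{cocone}(y)$ (unique up to isomorphism). Negative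 first extensions: $\mathscr{C}$ has a negative first extension structure if it is equipped with an additive bifunctor $\mathbb{E}^{-1}:\mathscr{C}^{op}\times\mathscr{C}\to Ab$ and, for each $\delta\in\mathbb{E}(C,A)$, natural transformations $\delta^{-1}_\sharp:\mathbb{E}^{-1}(-,C)\to\mathscr{C}(-,A)$ and $\delta_{-1}^\sharp:\mathbb{E}^{-1}(A,-)\to\mathscr{C}(C,-)$ such that for each $\mathbb{E}$-triangle $A\xrightarrow{f}B\xrightarrow{g}C\overset{\delta}{\dashrightarrow}$ and each $W\in\mathscr{C}$ the sequences $$\mathbb{E}^{-1}(W,A)\to\mathbb{E}^{-1}(W,B)\to\mathbb{E}^{-1}(W,C)\xrightarrow{(\delta^{-1}_\sharp)_W}\mathscr{C}(W,A)\to\mathscr{C}(W,B),$$ $$\mathbb{E}^{-1}(C,W)\to\mathbb{E}^{-1}(B,W)\to\mathbb{E}^{-1}(A,W)\xrightarrow{(\delta_{-1}^\sharp)_W}\mathscr{C}(C,W)\to\mathscr{C}(B,W)$$ (unlabelled maps induced by $f$ and $g$) are exact. $s$-torsion pair: a pair $(\mathcal{T},\mathcal{F})$ of subcategories of $\mathscr{C}$ such that (1) $\mathscr{C}=\mathcal{T}*\mathcal{F}$, i.e. every $X\in\mathscr{C}$ admits an $\mathbb{E}$-triangle $T\to X\to F\dashrightarrow$ with $T\in\mathcal{T}$, $F\in\mathcal{F}$; (2) $\mathscr{C}(\mathcal{T},\mathcal{F})=0$; (3) $\mathbb{E}^{-1}(\mathcal{T},\mathcal{F})=0$. Inflation factorization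 system: for inflations $l,r$ write $l\perp r$ if $\mathscr{C}(\mathrm{cone}(l),\mathrm{cone}(r))=0$ and $\mathbb{E}^{-1}(\mathrm{cone}(l),\mathrm{cone}(r))=0$. For a class $\mathcal{I}$ of inflations, $\mathcal{I}^\perp=\{f\text{ inflation}\mid g\perp f\ \forall g\in\mathcal{I}\}$ and ${}^\perp\mathcal{I}=\{f\text{ inflation}\mid f\perp g\ \forall g\in\mathcal{I}\}$. A pair $(\mathcal{L},\mathcal{R})$ of classes of inflations is an inflation factorization system if (1) each inflation $f$ has a factorization $f=rl$ with $l\in\mathcal{L}$, $r\in\mathcal{R}$; (2) $\mathcal{L}={}^\perp\mathcal{R}$; (3) $\mathcal{L}^\perp=\mathcal{R}$. For a subcategory $\mathcal{U}$, $\mathrm{Infl}\,\mathcal{U}=\{f\text{ an inflation}\mid\mathrm{cone}(f)\in\mathcal{U}\}$. For a class $\mathcal{I}$ of inflations, $\mathrm{Cone}(\mathcal{I})=\{U\in\mathscr{C}\mid U\cong\mathrm{cone}(f)\text{ for some }f\in\mathcal{I}\}$. *)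

theory Defs
  imports "HOL-Algebra.Elementary_Groups"
begin

section \<open>Additive categories\<close>

text \<open>Abelian groups are objects of the locale \<^locale>\<open>comm_group\<close>. They are therefore written
  multiplicatively: \<open>\<otimes>\<close> is the sum and \<open>\<one>\<close> the zero of a group of morphisms or of extensions.
  Only objects in \<open>Obj\<close> belong to the category. A morphism determines its source and target,
  so that a class of morphisms is a set. \<open>g \<cdot> f\<close> is \<open>g\<close> after \<open>f\<close>.\<close>

record ('o, 'm) category_data =
  Obj :: "'o set"
  Dom :: "'m \<Rightarrow> 'o"
  Cod :: "'m \<Rightarrow> 'o"
  Hom :: "'o \<Rightarrow> 'o \<Rightarrow> 'm monoid"
  Ident :: "'o \<Rightarrow> 'm"
  Comp :: "'m \<Rightarrow> 'm \<Rightarrow> 'm"  (infixl \<open>\<cdot>\<index>\<close> 70)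

abbreviation mor :: "('o, 'm, 'z) category_data_scheme \<Rightarrow> 'o \<Rightarrow> 'o \<Rightarrow> 'm set"
  where "mor \<C> A B \<equiv> carrier (Hom \<C> A B)"

definition is_iso :: "('o, 'm, 'z) category_data_scheme \<Rightarrow> 'o \<Rightarrow> 'o \<Rightarrow> 'm \<Rightarrow> bool"
  where "is_iso \<C> A B f \<longleftrightarrow> f \<in> mor \<C> A B \<and>
    (\<exists>g \<in> mor \<C> B A. g \<cdot>\<^bsub>\<C>\<^esub> f = Ident \<C> A \<and> f \<cdot>\<^bsub>\<C>\<^esub> g = Ident \<C> B)"

definition isomorphic :: "('o, 'm, 'z) category_data_scheme \<Rightarrow> 'o \<Rightarrow> 'o \<Rightarrow> bool"
  where "isomorphic \<C> A B \<longleftrightarrow> (\<exists>f. is_iso \<C> A B f)"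

definition is_biproduct ::
  "('o, 'm, 'z) category_data_scheme \<Rightarrow> 'o \<Rightarrow> 'o \<Rightarrow> 'o \<Rightarrow> 'm \<Rightarrow> 'm \<Rightarrow> 'm \<Rightarrow> 'm \<Rightarrow> bool"
  where "is_biproduct \<C> A B S i j p q \<longleftrightarrow>
    A \<in> Obj \<C> \<and> B \<in> Obj \<C> \<and> S \<in> Obj \<C> \<and>
    i \<in> mor \<C> A S \<and> j \<in> mor \<C> B S \<and> p \<in> mor \<C> S A \<and> q \<in> mor \<C> S B \<and>
    p \<cdot>\<^bsub>\<C>\<^esub> i = Ident \<C> A \<and> q \<cdot>\<^bsub>\<C>\<^esub> j = Ident \<C> B \<and>
    p \<cdot>\<^bsub>\<C>\<^esub> j = \<one>\<^bsub>Hom \<C> B A\<^esub> \<and> q \<cdot>\<^bsub>\<C>\<^esub> i = \<one>\<^bsub>Hom \<C> A B\<^esub> \<and>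
    (i \<cdot>\<^bsub>\<C>\<^esub> p) \<otimes>\<^bsub>Hom \<C> S S\<^esub> (j \<cdot>\<^bsub>\<C>\<^esub> q) = Ident \<C> S"

locale additive_category =
  fixes \<C> :: "('o, 'm, 'z) category_data_scheme" (structure)
  assumes Dom_Cod: "\<lbrakk>A \<in> Obj \<C>; B \<in> Obj \<C>; f \<in> mor \<C> A B\<rbrakk> \<Longrightarrow> Dom \<C> f = A \<and> Cod \<C> f = B"
    and Ident_closed: "A \<in> Obj \<C> \<Longrightarrow> Ident \<C> A \<in> mor \<C> A A"
    and Comp_closed: "\<lbrakk>A \<in> Obj \<C>; B \<in> Obj \<C>; C \<in> Obj \<C>; f \<in> mor \<C> A B; g \<in> mor \<C> B C\<rbrakk>
      \<Longrightarrow> g \<cdot> f \<in> mor \<C> A C"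
    and Comp_assoc: "\<lbrakk>A \<in> Obj \<C>; B \<in> Obj \<C>; C \<in> Obj \<C>; D \<in> Obj \<C>;
        f \<in> mor \<C> A B; g \<in> mor \<C> B C; h \<in> mor \<C> C D\<rbrakk>
      \<Longrightarrow> h \<cdot> g \<cdot> f = h \<cdot> (g \<cdot> f)"
    and Comp_Ident_left: "\<lbrakk>A \<in> Obj \<C>; B \<in> Obj \<C>; f \<in> mor \<C> A B\<rbrakk> \<Longrightarrow> Ident \<C> B \<cdot> f = f"
    and Comp_Ident_right: "\<lbrakk>A \<in> Obj \<C>; B \<in> Obj \<C>; f \<in> mor \<C> A B\<rbrakk> \<Longrightarrow> f \<cdot> Ident \<C> A = f"
    and Hom_comm_group: "\<lbrakk>A \<in> Obj \<C>; B \<in> Obj \<C>\<rbrakk> \<Longrightarrow> comm_group (Hom \<C> A B)"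
    and Comp_add_right: "\<lbrakk>A \<in> Obj \<C>; B \<in> Obj \<C>; C \<in> Obj \<C>;
        f \<in> mor \<C> A B; f' \<in> mor \<C> A B; g \<in> mor \<C> B C\<rbrakk>
      \<Longrightarrow> g \<cdot> (f \<otimes>\<^bsub>Hom \<C> A B\<^esub> f') = (g \<cdot> f) \<otimes>\<^bsub>Hom \<C> A C\<^esub> (g \<cdot> f')"
    and Comp_add_left: "\<lbrakk>A \<in> Obj \<C>; B \<in> Obj \<C>; C \<in> Obj \<C>;
        f \<in> mor \<C> A B; g \<in> mor \<C> B C; g' \<in> mor \<C> B C\<rbrakk>
      \<Longrightarrow> (g \<otimes>\<^bsub>Hom \<C> B C\<^esub> g') \<cdot> f = (g \<cdot> f) \<otimes>\<^bsub>Hom \<C> A C\<^esub> (g' \<cdot> f)"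
    and zero_object: "\<exists>Z \<in> Obj \<C>. \<forall>X \<in> Obj \<C>. trivial_group (Hom \<C> X Z) \<and> trivial_group (Hom \<C> Z X)"
    and biproducts: "\<lbrakk>A \<in> Obj \<C>; B \<in> Obj \<C>\<rbrakk> \<Longrightarrow> \<exists>S i j p q. is_biproduct \<C> A B S i j p q"

text \<open>A biadditive functor \<open>\<C>\<^sup>o\<^sup>p \<times> \<C> \<rightarrow> Ab\<close>, \<open>(C, A) \<mapsto> G C A\<close>; for \<open>c : C' \<rightarrow> C\<close> and
  \<open>a : A \<rightarrow> A'\<close> the induced map \<open>G C A \<rightarrow> G C' A'\<close> is \<open>F c a\<close>.\<close>

locale biadditive_functor = additive_category \<C>
  for \<C> :: "('o, 'm, 'z) category_data_scheme" (structure)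
    and G :: "'o \<Rightarrow> 'o \<Rightarrow> 'x monoid"
    and F :: "'m \<Rightarrow> 'm \<Rightarrow> 'x \<Rightarrow> 'x" +
  assumes group_value: "\<lbrakk>C \<in> Obj \<C>; A \<in> Obj \<C>\<rbrakk> \<Longrightarrow> comm_group (G C A)"
    and map_hom: "\<lbrakk>C \<in> Obj \<C>; C' \<in> Obj \<C>; A \<in> Obj \<C>; A' \<in> Obj \<C>; c \<in> mor \<C> C' C; a \<in> mor \<C> A A'\<rbrakk>
      \<Longrightarrow> F c a \<in> hom (G C A) (G C' A')"
    and map_Ident: "\<lbrakk>C \<in> Obj \<C>; A \<in> Obj \<C>; \<delta> \<in> carrier (G C A)\<rbrakk>
      \<Longrightarrow> F (Ident \<C> C) (Ident \<C> A) \<delta> = \<delta>"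
    and map_Comp: "\<lbrakk>C \<in> Obj \<C>; C' \<in> Obj \<C>; C'' \<in> Obj \<C>; A \<in> Obj \<C>; A' \<in> Obj \<C>; A'' \<in> Obj \<C>;
        c \<in> mor \<C> C' C; c' \<in> mor \<C> C'' C'; a \<in> mor \<C> A A'; a' \<in> mor \<C> A' A'';
        \<delta> \<in> carrier (G C A)\<rbrakk>
      \<Longrightarrow> F (c \<cdot> c') (a' \<cdot> a) \<delta> = F c' a' (F c a \<delta>)"
    and map_add_left: "\<lbrakk>C \<in> Obj \<C>; C' \<in> Obj \<C>; A \<in> Obj \<C>; A' \<in> Obj \<C>;
        c \<in> mor \<C> C' C; d \<in> mor \<C> C' C; a \<in> mor \<C> A A'; \<delta> \<in> carrier (G C A)\<rbrakk>
      \<Longrightarrow> F (c \<otimes>\<^bsub>Hom \<C> C' C\<^esub> d) a \<delta> = F c a \<delta> \<otimes>\<^bsub>G C' A'\<^esub> F d a \<delta>"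
    and map_add_right: "\<lbrakk>C \<in> Obj \<C>; C' \<in> Obj \<C>; A \<in> Obj \<C>; A' \<in> Obj \<C>;
        c \<in> mor \<C> C' C; a \<in> mor \<C> A A'; b \<in> mor \<C> A A'; \<delta> \<in> carrier (G C A)\<rbrakk>
      \<Longrightarrow> F c (a \<otimes>\<^bsub>Hom \<C> A A'\<^esub> b) \<delta> = F c a \<delta> \<otimes>\<^bsub>G C' A'\<^esub> F c b \<delta>"


section \<open>Extriangulated categories\<close>

text \<open>\<open>Ext \<C> C A\<close> is \<open>\<bbbE>(C, A)\<close>, \<open>ExtMap \<C> c a\<close> is \<open>\<bbbE>(c, a)\<close>, and \<open>Realization \<C> C A \<delta>\<close> is the
  equivalence class, as a set of pairs \<open>(x, y)\<close>, assigned to \<open>\<delta> \<in> \<bbbE>(C, A)\<close>.\<close>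

record ('o, 'm, 'e) extriangulated_data = "('o, 'm) category_data" +
  Ext :: "'o \<Rightarrow> 'o \<Rightarrow> 'e monoid"
  ExtMap :: "'m \<Rightarrow> 'm \<Rightarrow> 'e \<Rightarrow> 'e"
  Realization :: "'o \<Rightarrow> 'o \<Rightarrow> 'e \<Rightarrow> ('m \<times> 'm) set"

definition push ::
  "('o, 'm, 'e, 'z) extriangulated_data_scheme \<Rightarrow> 'o \<Rightarrow> 'm \<Rightarrow> 'e \<Rightarrow> 'e"
  where "push \<C> C a \<delta> = ExtMap \<C> (Ident \<C> C) a \<delta>"

definition pull ::
  "('o, 'm, 'e, 'z) extriangulated_data_scheme \<Rightarrow> 'o \<Rightarrow> 'm \<Rightarrow> 'e \<Rightarrow> 'e"
  where "pull \<C> A c \<delta> = ExtMap \<C> c (Ident \<C> A) \<delta>"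

definition seq_class ::
  "('o, 'm, 'z) category_data_scheme \<Rightarrow> 'o \<Rightarrow> 'o \<Rightarrow> 'o \<Rightarrow> 'm \<Rightarrow> 'm \<Rightarrow> ('m \<times> 'm) set"
  where "seq_class \<C> A B C x y =
    {(x', y'). \<exists>B' \<in> Obj \<C>. x' \<in> mor \<C> A B' \<and> y' \<in> mor \<C> B' C \<and>
       (\<exists>b. is_iso \<C> B B' b \<and> b \<cdot>\<^bsub>\<C>\<^esub> x = x' \<and> y' \<cdot>\<^bsub>\<C>\<^esub> b = y)}"

definition E_triangle ::
  "('o, 'm, 'e, 'z) extriangulated_data_scheme \<Rightarrow> 'o \<Rightarrow> 'm \<Rightarrow> 'o \<Rightarrow> 'm \<Rightarrow> 'o \<Rightarrow> 'e \<Rightarrow> bool"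
  where "E_triangle \<C> A x B y C \<delta> \<longleftrightarrow>
    A \<in> Obj \<C> \<and> B \<in> Obj \<C> \<and> C \<in> Obj \<C> \<and> x \<in> mor \<C> A B \<and> y \<in> mor \<C> B C \<and>
    \<delta> \<in> carrier (Ext \<C> C A) \<and> Realization \<C> C A \<delta> = seq_class \<C> A B C x y"

definition ext_morphism ::
  "('o, 'm, 'e, 'z) extriangulated_data_scheme \<Rightarrow> 'o \<Rightarrow> 'o \<Rightarrow> 'e \<Rightarrow> 'o \<Rightarrow> 'o \<Rightarrow> 'e \<Rightarrow> 'm \<Rightarrow> 'm \<Rightarrow> bool"
  where "ext_morphism \<C> C A \<delta> C' A' \<delta>' a c \<longleftrightarrow>
    a \<in> mor \<C> A A' \<and> c \<in> mor \<C> C C' \<and> push \<C> C a \<delta> = pull \<C> A' c \<delta>'"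

locale extriangulated_category =
  biadditive_functor \<C> "Ext \<C>" "ExtMap \<C>"
  for \<C> :: "('o, 'm, 'e, 'z) extriangulated_data_scheme" (structure) +
  assumes realization_class: "\<lbrakk>A \<in> Obj \<C>; C \<in> Obj \<C>; \<delta> \<in> carrier (Ext \<C> C A)\<rbrakk>
      \<Longrightarrow> \<exists>B x y. E_triangle \<C> A x B y C \<delta>"
    and realization_morphism:
      "\<lbrakk>E_triangle \<C> A x B y C \<delta>; E_triangle \<C> A' x' B' y' C' \<delta>'; ext_morphism \<C> C A \<delta> C' A' \<delta>' a c\<rbrakk>
      \<Longrightarrow> \<exists>b \<in> mor \<C> B B'. b \<cdot> x = x' \<cdot> a \<and> y' \<cdot> b = c \<cdot> y"
    and realization_zero: "is_biproduct \<C> A C S i j p q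
      \<Longrightarrow> E_triangle \<C> A i S q C \<one>\<^bsub>Ext \<C> C A\<^esub>"
    \<comment> \<open>\<open>\<theta>\<close> is \<open>\<delta> \<oplus> \<delta>'\<close>, the element with components \<open>(\<delta>, 0, 0, \<delta>')\<close> under
      \<open>\<bbbE>(C \<oplus> C', A \<oplus> A') \<cong> \<bbbE>(C, A) \<oplus> \<bbbE>(C, A') \<oplus> \<bbbE>(C', A) \<oplus> \<bbbE>(C', A')\<close>.\<close>
    and realization_sum:
      "\<lbrakk>E_triangle \<C> A x B y C \<delta>; E_triangle \<C> A' x' B' y' C' \<delta>';
        is_biproduct \<C> A A' SA iA jA pA qA;
        is_biproduct \<C> B B' SB iB jB pB qB;
        is_biproduct \<C> C C' SC iC jC pC qC;
        \<theta> \<in> carrier (Ext \<C> SC SA);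
        ExtMap \<C> iC pA \<theta> = \<delta>; ExtMap \<C> iC qA \<theta> = \<one>\<^bsub>Ext \<C> C A'\<^esub>;
        ExtMap \<C> jC pA \<theta> = \<one>\<^bsub>Ext \<C> C' A\<^esub>; ExtMap \<C> jC qA \<theta> = \<delta>'\<rbrakk>
      \<Longrightarrow> E_triangle \<C> SA ((iB \<cdot> x \<cdot> pA) \<otimes>\<^bsub>Hom \<C> SA SB\<^esub> (jB \<cdot> x' \<cdot> qA)) SB
            ((iC \<cdot> y \<cdot> pB) \<otimes>\<^bsub>Hom \<C> SB SC\<^esub> (jC \<cdot> y' \<cdot> qB)) SC \<theta>"
    and ET3:
      "\<lbrakk>E_triangle \<C> A x B y C \<delta>; E_triangle \<C> A' x' B' y' C' \<delta>';
        a \<in> mor \<C> A A'; b \<in> mor \<C> B B'; b \<cdot> x = x' \<cdot> a\<rbrakk>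
      \<Longrightarrow> \<exists>c \<in> mor \<C> C C'. c \<cdot> y = y' \<cdot> b \<and> push \<C> C a \<delta> = pull \<C> A' c \<delta>'"
    and ET3_op:
      "\<lbrakk>E_triangle \<C> A x B y C \<delta>; E_triangle \<C> A' x' B' y' C' \<delta>';
        b \<in> mor \<C> B B'; c \<in> mor \<C> C C'; c \<cdot> y = y' \<cdot> b\<rbrakk>
      \<Longrightarrow> \<exists>a \<in> mor \<C> A A'. b \<cdot> x = x' \<cdot> a \<and> push \<C> C a \<delta> = pull \<C> A' c \<delta>'"
    and ET4:
      "\<lbrakk>E_triangle \<C> A f B f' D \<delta>; E_triangle \<C> B g C g' F \<delta>'\<rbrakk>
      \<Longrightarrow> \<exists>E \<in> Obj \<C>. \<exists>h' \<in> mor \<C> C E. \<exists>d \<in> mor \<C> D E. \<exists>e \<in> mor \<C> E F. \<exists>\<delta>'' \<in> carrier (Ext \<C> E A).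
            h' \<cdot> g = d \<cdot> f' \<and> e \<cdot> h' = g' \<and>
            E_triangle \<C> A (g \<cdot> f) C h' E \<delta>'' \<and>
            E_triangle \<C> D d E e F (push \<C> F f' \<delta>') \<and>
            pull \<C> A d \<delta>'' = \<delta> \<and> push \<C> E f \<delta>'' = pull \<C> B e \<delta>'"
    and ET4_op:
      "\<lbrakk>E_triangle \<C> D f' B f A \<delta>; E_triangle \<C> F g' C g B \<delta>'\<rbrakk>
      \<Longrightarrow> \<exists>E \<in> Obj \<C>. \<exists>h' \<in> mor \<C> E C. \<exists>d \<in> mor \<C> E D. \<exists>e \<in> mor \<C> F E. \<exists>\<delta>'' \<in> carrier (Ext \<C> A E).
            g \<cdot> h' = f' \<cdot> d \<and> h' \<cdot> e = g' \<and>
            E_triangle \<C> E h' C (f \<cdot> g) A \<delta>'' \<and>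
            E_triangle \<C> F e E d D (pull \<C> F f' \<delta>') \<and>
            push \<C> A d \<delta>'' = \<delta> \<and> pull \<C> E f \<delta>'' = push \<C> B e \<delta>'"

definition inflation :: "('o, 'm, 'e, 'z) extriangulated_data_scheme \<Rightarrow> 'm \<Rightarrow> bool"
  where "inflation \<C> x \<longleftrightarrow> (\<exists>A B y C \<delta>. E_triangle \<C> A x B y C \<delta>)"

text \<open>The cone of an inflation is only determined up to isomorphism; this is a choice of one.\<close>

definition cone :: "('o, 'm, 'e, 'z) extriangulated_data_scheme \<Rightarrow> 'm \<Rightarrow> 'o"
  where "cone \<C> x = (SOME C. \<exists>A B y \<delta>. E_triangle \<C> A x B y C \<delta>)"


section \<open>Negative first extensions\<close>

text \<open>For \<open>\<delta> \<in> \<bbbE>(C, A)\<close>, \<open>SharpLeft \<C> C A \<delta> W\<close> is the component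
  \<open>\<bbbE>\<^sup>-\<^sup>1(W, C) \<rightarrow> \<C>(W, A)\<close> of \<open>\<delta>\<^sup>-\<^sup>1\<^sub>\<sharp>\<close>, and \<open>SharpRight \<C> C A \<delta> W\<close> is the component
  \<open>\<bbbE>\<^sup>-\<^sup>1(A, W) \<rightarrow> \<C>(C, W)\<close> of \<open>\<delta>\<^sub>-\<^sub>1\<^sup>\<sharp>\<close>.\<close>

record ('o, 'm, 'e, 'n) neg_extriangulated_data = "('o, 'm, 'e) extriangulated_data" +
  NegExt :: "'o \<Rightarrow> 'o \<Rightarrow> 'n monoid"
  NegExtMap :: "'m \<Rightarrow> 'm \<Rightarrow> 'n \<Rightarrow> 'n"
  SharpLeft :: "'o \<Rightarrow> 'o \<Rightarrow> 'e \<Rightarrow> 'o \<Rightarrow> 'n \<Rightarrow> 'm"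
  SharpRight :: "'o \<Rightarrow> 'o \<Rightarrow> 'e \<Rightarrow> 'o \<Rightarrow> 'n \<Rightarrow> 'm"

definition exact_at ::
  "('a, 'r) monoid_scheme \<Rightarrow> ('a \<Rightarrow> 'b) \<Rightarrow> ('b, 's) monoid_scheme \<Rightarrow> ('b \<Rightarrow> 'c) \<Rightarrow> ('c, 't) monoid_scheme \<Rightarrow> bool"
  where "exact_at G f H g K \<longleftrightarrow> f ` carrier G = kernel H K g"

locale neg_extriangulated_category =
  extriangulated_category \<C> + neg: biadditive_functor \<C> "NegExt \<C>" "NegExtMap \<C>"
  for \<C> :: "('o, 'm, 'e, 'n, 'z) neg_extriangulated_data_scheme" (structure) +
  assumes SharpLeft_hom:
      "\<lbrakk>A \<in> Obj \<C>; C \<in> Obj \<C>; W \<in> Obj \<C>; \<delta> \<in> carrier (Ext \<C> C A)\<rbrakk>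
      \<Longrightarrow> SharpLeft \<C> C A \<delta> W \<in> hom (NegExt \<C> W C) (Hom \<C> W A)"
    and SharpLeft_natural:
      "\<lbrakk>A \<in> Obj \<C>; C \<in> Obj \<C>; W \<in> Obj \<C>; W' \<in> Obj \<C>; \<delta> \<in> carrier (Ext \<C> C A);
        w \<in> mor \<C> W' W; \<nu> \<in> carrier (NegExt \<C> W C)\<rbrakk>
      \<Longrightarrow> SharpLeft \<C> C A \<delta> W' (NegExtMap \<C> w (Ident \<C> C) \<nu>) = SharpLeft \<C> C A \<delta> W \<nu> \<cdot> w"
    and SharpRight_hom:
      "\<lbrakk>A \<in> Obj \<C>; C \<in> Obj \<C>; W \<in> Obj \<C>; \<delta> \<in> carrier (Ext \<C> C A)\<rbrakk>
      \<Longrightarrow> SharpRight \<C> C A \<delta> W \<in> hom (NegExt \<C> A W) (Hom \<C> C W)"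
    and SharpRight_natural:
      "\<lbrakk>A \<in> Obj \<C>; C \<in> Obj \<C>; W \<in> Obj \<C>; W' \<in> Obj \<C>; \<delta> \<in> carrier (Ext \<C> C A);
        w \<in> mor \<C> W W'; \<nu> \<in> carrier (NegExt \<C> A W)\<rbrakk>
      \<Longrightarrow> SharpRight \<C> C A \<delta> W' (NegExtMap \<C> (Ident \<C> A) w \<nu>) = w \<cdot> SharpRight \<C> C A \<delta> W \<nu>"
    and exact_left: "\<lbrakk>E_triangle \<C> A f B g C \<delta>; W \<in> Obj \<C>\<rbrakk> \<Longrightarrow>
        exact_at (NegExt \<C> W A) (NegExtMap \<C> (Ident \<C> W) f)
          (NegExt \<C> W B) (NegExtMap \<C> (Ident \<C> W) g) (NegExt \<C> W C) \<and>
        exact_at (NegExt \<C> W B) (NegExtMap \<C> (Ident \<C> W) g)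
          (NegExt \<C> W C) (SharpLeft \<C> C A \<delta> W) (Hom \<C> W A) \<and>
        exact_at (NegExt \<C> W C) (SharpLeft \<C> C A \<delta> W)
          (Hom \<C> W A) (\<lambda>h. f \<cdot> h) (Hom \<C> W B)"
    and exact_right: "\<lbrakk>E_triangle \<C> A f B g C \<delta>; W \<in> Obj \<C>\<rbrakk> \<Longrightarrow>
        exact_at (NegExt \<C> C W) (NegExtMap \<C> g (Ident \<C> W))
          (NegExt \<C> B W) (NegExtMap \<C> f (Ident \<C> W)) (NegExt \<C> A W) \<and>
        exact_at (NegExt \<C> B W) (NegExtMap \<C> f (Ident \<C> W))
          (NegExt \<C> A W) (SharpRight \<C> C A \<delta> W) (Hom \<C> C W) \<and>
        exact_at (NegExt \<C> A W) (SharpRight \<C> C A \<delta> W)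
          (Hom \<C> C W) (\<lambda>h. h \<cdot> g) (Hom \<C> B W)"


section \<open>Torsion pairs and inflation factorization systems\<close>

text \<open>A full subcategory closed under isomorphisms is given by its set of objects.\<close>

definition subcategory :: "('o, 'm, 'z) category_data_scheme \<Rightarrow> 'o set \<Rightarrow> bool"
  where "subcategory \<C> \<U> \<longleftrightarrow> \<U> \<subseteq> Obj \<C> \<and>
    (\<forall>X \<in> \<U>. \<forall>Y \<in> Obj \<C>. isomorphic \<C> X Y \<longrightarrow> Y \<in> \<U>)"

definition s_torsion_pair ::
  "('o, 'm, 'e, 'n, 'z) neg_extriangulated_data_scheme \<Rightarrow> 'o set \<Rightarrow> 'o set \<Rightarrow> bool"
  where "s_torsion_pair \<C> \<T> \<F> \<longleftrightarrow>
    subcategory \<C> \<T> \<and> subcategory \<C> \<F> \<and>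
    (\<forall>X \<in> Obj \<C>. \<exists>T \<in> \<T>. \<exists>F \<in> \<F>. \<exists>x y \<delta>. E_triangle \<C> T x X y F \<delta>) \<and>
    (\<forall>T \<in> \<T>. \<forall>F \<in> \<F>. trivial_group (Hom \<C> T F)) \<and>
    (\<forall>T \<in> \<T>. \<forall>F \<in> \<F>. trivial_group (NegExt \<C> T F))"

definition infl_orth ::
  "('o, 'm, 'e, 'n, 'z) neg_extriangulated_data_scheme \<Rightarrow> 'm \<Rightarrow> 'm \<Rightarrow> bool"
  where "infl_orth \<C> l r \<longleftrightarrow>
    trivial_group (Hom \<C> (cone \<C> l) (cone \<C> r)) \<and>
    trivial_group (NegExt \<C> (cone \<C> l) (cone \<C> r))"

definition right_perp ::
  "('o, 'm, 'e, 'n, 'z) neg_extriangulated_data_scheme \<Rightarrow> 'm set \<Rightarrow> 'm set"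
  where "right_perp \<C> \<I> = {f. inflation \<C> f \<and> (\<forall>g \<in> \<I>. infl_orth \<C> g f)}"

definition left_perp ::
  "('o, 'm, 'e, 'n, 'z) neg_extriangulated_data_scheme \<Rightarrow> 'm set \<Rightarrow> 'm set"
  where "left_perp \<C> \<I> = {f. inflation \<C> f \<and> (\<forall>g \<in> \<I>. infl_orth \<C> f g)}"

definition inflation_factorization_system ::
  "('o, 'm, 'e, 'n, 'z) neg_extriangulated_data_scheme \<Rightarrow> 'm set \<Rightarrow> 'm set \<Rightarrow> bool"
  where "inflation_factorization_system \<C> \<L> \<R> \<longleftrightarrow>
    \<L> \<subseteq> Collect (inflation \<C>) \<and> \<R> \<subseteq> Collect (inflation \<C>) \<and>
    (\<forall>f. inflation \<C> f \<longrightarrow>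
      (\<exists>l \<in> \<L>. \<exists>r \<in> \<R>. Cod \<C> l = Dom \<C> r \<and> f = r \<cdot>\<^bsub>\<C>\<^esub> l)) \<and>
    \<L> = left_perp \<C> \<R> \<and> right_perp \<C> \<L> = \<R>"

definition Infl :: "('o, 'm, 'e, 'z) extriangulated_data_scheme \<Rightarrow> 'o set \<Rightarrow> 'm set"
  where "Infl \<C> \<U> = {f. inflation \<C> f \<and> cone \<C> f \<in> \<U>}"

definition Cone :: "('o, 'm, 'e, 'z) extriangulated_data_scheme \<Rightarrow> 'm set \<Rightarrow> 'o set"
  where "Cone \<C> \<I> = {U \<in> Obj \<C>. \<exists>f \<in> \<I>. isomorphic \<C> U (cone \<C> f)}"

definition mutually_inverse_bijections ::
  "('a \<Rightarrow> 'b) \<Rightarrow> ('b \<Rightarrow> 'a) \<Rightarrow> 'a set \<Rightarrow> 'b set \<Rightarrow> bool"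
  where "mutually_inverse_bijections \<Phi> \<Psi> X Y \<longleftrightarrow>
    bij_betw \<Phi> X Y \<and> bij_betw \<Psi> Y X \<and> (\<forall>x \<in> X. \<Psi> (\<Phi> x) = x) \<and> (\<forall>y \<in> Y. \<Phi> (\<Psi> y) = y)"

end

theory Submission
  imports Defs
begin

text \<open>
  Through the inflations \<open>0 \<rightarrow> X\<close>, whose cone is \<open>X\<close>, classes of objects are recovered from
  classes of inflations, and the orthogonality conditions on both sides correspond. A factorization
  of \<open>f\<close> arises from the torsion triangle of \<open>cone f\<close> by (ET4)\<open>\<^sup>o\<^sup>p\<close>; conversely, factoring
  \<open>0 \<rightarrow> X\<close> as \<open>0 \<rightarrow> E \<rightarrow> X\<close> gives the torsion triangle \<open>E \<rightarrow> X \<rightarrow> cone r\<close>. The vanishing of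
  \<open>\<bbbE>\<^sup>-\<^sup>1(\<T>, \<F>)\<close> makes each half of a torsion pair the \<open>Hom\<close>-orthogonal of the other.
\<close>

section \<open>Zero morphisms and isomorphisms\<close>

definition is_zero_object :: "('o, 'm, 'z) category_data_scheme \<Rightarrow> 'o \<Rightarrow> bool"
  where "is_zero_object \<C> Z \<longleftrightarrow> Z \<in> Obj \<C> \<and>
    (\<forall>X \<in> Obj \<C>. trivial_group (Hom \<C> X Z) \<and> trivial_group (Hom \<C> Z X))"

context additive_category
begin

section \<open>Zero morphisms and trivial morphism groups\<close>

lemma zero_closed:
  assumes "A \<in> Obj \<C>" "B \<in> Obj \<C>"
  shows "\<one>\<^bsub>Hom \<C> A B\<^esub> \<in> mor \<C> A B"
proof -
  interpret comm_group "Hom \<C> A B" using assms by (rule Hom_comm_group)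
  show ?thesis by simp
qed

lemma trivial_Hom_iff:
  assumes "A \<in> Obj \<C>" "B \<in> Obj \<C>"
  shows "trivial_group (Hom \<C> A B) \<longleftrightarrow> (\<forall>f \<in> mor \<C> A B. f = \<one>\<^bsub>Hom \<C> A B\<^esub>)"
proof -
  interpret comm_group "Hom \<C> A B" using assms by (rule Hom_comm_group)
  show ?thesis unfolding trivial_group_def using is_group one_closed by blast
qed

text \<open>Composition is additive in its left argument, so the composite \<open>z\<close>
  satisfies \<open>z + z = z\<close> and is the zero of its group.\<close>

lemma comp_zero_left:
  assumes "A \<in> Obj \<C>" "B \<in> Obj \<C>" "C \<in> Obj \<C>" "f \<in> mor \<C> A B"
  shows "\<one>\<^bsub>Hom \<C> B C\<^esub> \<cdot> f = \<one>\<^bsub>Hom \<C> A C\<^esub>"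
proof -
  interpret BC: comm_group "Hom \<C> B C" using assms by (intro Hom_comm_group)
  interpret AC: comm_group "Hom \<C> A C" using assms by (intro Hom_comm_group)
  let ?z = "\<one>\<^bsub>Hom \<C> B C\<^esub> \<cdot> f"
  have "?z \<otimes>\<^bsub>Hom \<C> A C\<^esub> ?z = ?z"
    using Comp_add_left[OF assms BC.one_closed BC.one_closed] by simp
  moreover have "?z \<in> mor \<C> A C" using assms by (intro Comp_closed[of A B C]) auto
  ultimately show ?thesis by (simp add: AC.l_cancel_one')
qed

lemma comp_zero_right:
  assumes "A \<in> Obj \<C>" "B \<in> Obj \<C>" "C \<in> Obj \<C>" "f \<in> mor \<C> B C"
  shows "f \<cdot> \<one>\<^bsub>Hom \<C> A B\<^esub> = \<one>\<^bsub>Hom \<C> A C\<^esub>"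
proof -
  interpret AB: comm_group "Hom \<C> A B" using assms by (intro Hom_comm_group)
  interpret AC: comm_group "Hom \<C> A C" using assms by (intro Hom_comm_group)
  let ?z = "f \<cdot> \<one>\<^bsub>Hom \<C> A B\<^esub>"
  have "?z \<otimes>\<^bsub>Hom \<C> A C\<^esub> ?z = ?z"
    using Comp_add_right[OF assms(1-3) AB.one_closed AB.one_closed assms(4)] by simp
  moreover have "?z \<in> mor \<C> A C" using assms by (intro Comp_closed[of A B C]) auto
  ultimately show ?thesis by (simp add: AC.l_cancel_one')
qed

section \<open>Zero objects and the degenerate biproducts they give\<close>

lemma ex_zero_object: "\<exists>Z. is_zero_object \<C> Z"
  using zero_object unfolding is_zero_object_def by blast

lemma into_zero_object:
  "\<lbrakk>is_zero_object \<C> Z; X \<in> Obj \<C>; f \<in> mor \<C> X Z; g \<in> mor \<C> X Z\<rbrakk> \<Longrightarrow> f = g"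
  unfolding is_zero_object_def by (metis trivial_Hom_iff)

lemma from_zero_object:
  "\<lbrakk>is_zero_object \<C> Z; X \<in> Obj \<C>; f \<in> mor \<C> Z X; g \<in> mor \<C> Z X\<rbrakk> \<Longrightarrow> f = g"
  unfolding is_zero_object_def by (metis trivial_Hom_iff)

text \<open>Passed to \<open>realization_zero\<close>, this degenerate direct sum makes
  \<open>X = X \<rightarrow> Z\<close> an E-triangle. \<open>X\<close> itself may serve as the sum
  because biproducts are characterized by equations, not chosen.\<close>

lemma biproduct_zero_right:
  assumes Z: "is_zero_object \<C> Z" and X: "X \<in> Obj \<C>"
  shows "is_biproduct \<C> X Z X (Ident \<C> X) \<one>\<^bsub>Hom \<C> Z X\<^esub> (Ident \<C> X) \<one>\<^bsub>Hom \<C> X Z\<^esub>"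
proof -
  have Zo: "Z \<in> Obj \<C>" using Z by (simp add: is_zero_object_def)
  interpret XX: comm_group "Hom \<C> X X" using X X by (rule Hom_comm_group)
  note I = Ident_closed[OF X] Ident_closed[OF Zo] zero_closed[OF X Zo] zero_closed[OF Zo X]
  have "\<one>\<^bsub>Hom \<C> X Z\<^esub> \<cdot> \<one>\<^bsub>Hom \<C> Z X\<^esub> = Ident \<C> Z"
    using into_zero_object[OF Z Zo] I Comp_closed[OF Zo X Zo I(4,3)] by blast
  moreover have "\<one>\<^bsub>Hom \<C> Z X\<^esub> \<cdot> \<one>\<^bsub>Hom \<C> X Z\<^esub> = \<one>\<^bsub>Hom \<C> X X\<^esub>"
    using comp_zero_left[OF X Zo X I(3)] .
  ultimately show ?thesis
    unfolding is_biproduct_def using I X Zo by (simp add: Comp_Ident_left Comp_Ident_right)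
qed

lemma biproduct_zero_left:
  assumes Z: "is_zero_object \<C> Z" and X: "X \<in> Obj \<C>"
  shows "is_biproduct \<C> Z X X \<one>\<^bsub>Hom \<C> Z X\<^esub> (Ident \<C> X) \<one>\<^bsub>Hom \<C> X Z\<^esub> (Ident \<C> X)"
proof -
  interpret XX: comm_group "Hom \<C> X X" using X X by (rule Hom_comm_group)
  show ?thesis
    using biproduct_zero_right[OF assms] X Ident_closed[OF X] zero_closed
    unfolding is_biproduct_def
    by (metis Comp_closed XX.m_comm)
qed

section \<open>Isomorphisms and criteria for them\<close>

lemma isomorphicI:
  assumes "f \<in> mor \<C> A B" "g \<in> mor \<C> B A" "g \<cdot> f = Ident \<C> A" "f \<cdot> g = Ident \<C> B"
  shows "isomorphic \<C> A B"
  using assms unfolding isomorphic_def is_iso_def by blast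

lemma isomorphicE:
  assumes "isomorphic \<C> A B"
  obtains f g where "f \<in> mor \<C> A B" "g \<in> mor \<C> B A" "g \<cdot> f = Ident \<C> A" "f \<cdot> g = Ident \<C> B"
  using assms unfolding isomorphic_def is_iso_def by blast

lemma isomorphic_refl: "A \<in> Obj \<C> \<Longrightarrow> isomorphic \<C> A A"
  by (rule isomorphicI[of "Ident \<C> A" _ _ "Ident \<C> A"])
    (auto simp: Ident_closed Comp_Ident_left[OF _ _ Ident_closed])

lemma isomorphic_sym: "isomorphic \<C> A B \<Longrightarrow> isomorphic \<C> B A"
  by (auto elim!: isomorphicE intro: isomorphicI)

lemma isomorphic_trans:
  assumes O: "A \<in> Obj \<C>" "B \<in> Obj \<C>" "C \<in> Obj \<C>"
    and "isomorphic \<C> A B" "isomorphic \<C> B C"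
  shows "isomorphic \<C> A C"
proof -
  obtain f g where f: "f \<in> mor \<C> A B" "g \<in> mor \<C> B A" "g \<cdot> f = Ident \<C> A" "f \<cdot> g = Ident \<C> B"
    using assms(4) by (rule isomorphicE)
  obtain h k where h: "h \<in> mor \<C> B C" "k \<in> mor \<C> C B" "k \<cdot> h = Ident \<C> B" "h \<cdot> k = Ident \<C> C"
    using assms(5) by (rule isomorphicE)
  have hf: "h \<cdot> f \<in> mor \<C> A C" and gk: "g \<cdot> k \<in> mor \<C> C A"
    using O f h by (blast intro: Comp_closed)+
  have "g \<cdot> k \<cdot> (h \<cdot> f) = g \<cdot> (k \<cdot> h \<cdot> f)"
    using Comp_assoc[OF O(1,3,2,1) hf h(2) f(2)] Comp_assoc[OF O(1,2,3,2) f(1) h(1,2)] by simp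
  then have 1: "g \<cdot> k \<cdot> (h \<cdot> f) = Ident \<C> A"
    using O f h by (simp add: Comp_Ident_left)
  have "h \<cdot> f \<cdot> (g \<cdot> k) = h \<cdot> (f \<cdot> g \<cdot> k)"
    using Comp_assoc[OF O(3,1,2,3) gk f(1) h(1)] Comp_assoc[OF O(3,2,1,2) h(2) f(2,1)] by simp
  then have "h \<cdot> f \<cdot> (g \<cdot> k) = Ident \<C> C"
    using O f h by (simp add: Comp_Ident_left)
  with 1 show ?thesis using hf gk by (blast intro: isomorphicI)
qed

text \<open>Additivity turns \<open>f g f = f\<close> into \<open>f (1 - g f) = 0\<close>, so
  cancelling \<open>f\<close> makes \<open>g\<close> a two-sided inverse. Cancellation is asked for
  on endomorphisms of \<open>A\<close> and against zero, the form in which exact sequences supply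
  it.\<close>

lemma mono_split_epi_imp_isomorphic:
  assumes O: "A \<in> Obj \<C>" "B \<in> Obj \<C>" and f: "f \<in> mor \<C> A B"
    and g: "g \<in> mor \<C> B A" "f \<cdot> g = Ident \<C> B"
    and mono: "\<And>h. \<lbrakk>h \<in> mor \<C> A A; f \<cdot> h = \<one>\<^bsub>Hom \<C> A B\<^esub>\<rbrakk> \<Longrightarrow> h = \<one>\<^bsub>Hom \<C> A A\<^esub>"
  shows "isomorphic \<C> A B"
proof -
  interpret AA: comm_group "Hom \<C> A A" using O by (intro Hom_comm_group)
  have gf: "g \<cdot> f \<in> mor \<C> A A" using O f g by (blast intro: Comp_closed)
  have I: "Ident \<C> A \<in> mor \<C> A A" using O by (blast intro: Ident_closed)
  let ?i = "inv\<^bsub>Hom \<C> A A\<^esub> (g \<cdot> f)"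
  have i: "?i \<in> mor \<C> A A" using gf by simp
  have "f \<cdot> (g \<cdot> f) = f"
    using Comp_assoc[OF O(1,2,1,2) f g(1) f] g(2) Comp_Ident_left[OF O f] by simp
  then have "f \<cdot> (Ident \<C> A \<otimes>\<^bsub>Hom \<C> A A\<^esub> ?i) = f \<cdot> (g \<cdot> f \<otimes>\<^bsub>Hom \<C> A A\<^esub> ?i)"
    using Comp_add_right[OF O(1,1,2) I i f] Comp_add_right[OF O(1,1,2) gf i f]
      Comp_Ident_right[OF O f] by simp
  also have "\<dots> = \<one>\<^bsub>Hom \<C> A B\<^esub>"
    using gf comp_zero_right[OF O(1,1,2) f] by (simp add: AA.r_inv)
  finally have "Ident \<C> A \<otimes>\<^bsub>Hom \<C> A A\<^esub> ?i = \<one>\<^bsub>Hom \<C> A A\<^esub>"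
    using mono I i by blast
  then have "g \<cdot> f = Ident \<C> A"
    using I gf AA.inv_equality AA.inv_inv i by metis
  then show ?thesis using f g by (blast intro: isomorphicI)
qed

text \<open>Dually, \<open>(1 - f g) f = 0\<close>, and cancelling \<open>f\<close> on the right
  gives \<open>f g = 1\<close>.\<close>

lemma epi_split_mono_imp_isomorphic:
  assumes O: "A \<in> Obj \<C>" "B \<in> Obj \<C>" and f: "f \<in> mor \<C> A B"
    and g: "g \<in> mor \<C> B A" "g \<cdot> f = Ident \<C> A"
    and epi: "\<And>h. \<lbrakk>h \<in> mor \<C> B B; h \<cdot> f = \<one>\<^bsub>Hom \<C> A B\<^esub>\<rbrakk> \<Longrightarrow> h = \<one>\<^bsub>Hom \<C> B B\<^esub>"
  shows "isomorphic \<C> A B"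
proof -
  interpret BB: comm_group "Hom \<C> B B" using O by (intro Hom_comm_group)
  have fg: "f \<cdot> g \<in> mor \<C> B B" using O f g by (blast intro: Comp_closed)
  have I: "Ident \<C> B \<in> mor \<C> B B" using O by (blast intro: Ident_closed)
  let ?i = "inv\<^bsub>Hom \<C> B B\<^esub> (f \<cdot> g)"
  have i: "?i \<in> mor \<C> B B" using fg by simp
  have "f \<cdot> g \<cdot> f = f"
    using Comp_assoc[OF O(1,2,1,2) f g(1) f] g(2) Comp_Ident_right[OF O f] by simp
  then have "(Ident \<C> B \<otimes>\<^bsub>Hom \<C> B B\<^esub> ?i) \<cdot> f = (f \<cdot> g \<otimes>\<^bsub>Hom \<C> B B\<^esub> ?i) \<cdot> f"
    using Comp_add_left[OF O(1,2,2) f I i] Comp_add_left[OF O(1,2,2) f fg i]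
      Comp_Ident_left[OF O f] by simp
  also have "\<dots> = \<one>\<^bsub>Hom \<C> A B\<^esub>"
    using fg comp_zero_left[OF O(1,2,2) f] by (simp add: BB.r_inv)
  finally have "Ident \<C> B \<otimes>\<^bsub>Hom \<C> B B\<^esub> ?i = \<one>\<^bsub>Hom \<C> B B\<^esub>"
    using epi I i by blast
  then have "f \<cdot> g = Ident \<C> B"
    using I fg BB.inv_equality BB.inv_inv i by metis
  then show ?thesis using f g by (blast intro: isomorphicI)
qed

text \<open>Any \<open>f : A' \<rightarrow> B'\<close> equals \<open>b (b' f a) a'\<close>, and the
  bracket is a morphism \<open>A \<rightarrow> B\<close>, hence zero.\<close>

lemma trivial_Hom_iso:
  assumes O: "A \<in> Obj \<C>" "B \<in> Obj \<C>" "A' \<in> Obj \<C>" "B' \<in> Obj \<C>"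
    and "isomorphic \<C> A A'" "isomorphic \<C> B B'" and t: "trivial_group (Hom \<C> A B)"
  shows "trivial_group (Hom \<C> A' B')"
proof -
  obtain a a' where a: "a \<in> mor \<C> A A'" "a' \<in> mor \<C> A' A" "a \<cdot> a' = Ident \<C> A'"
    using assms(5) by (rule isomorphicE)
  obtain b b' where b: "b \<in> mor \<C> B B'" "b' \<in> mor \<C> B' B" "b \<cdot> b' = Ident \<C> B'"
    using assms(6) by (rule isomorphicE)
  have "f = \<one>\<^bsub>Hom \<C> A' B'\<^esub>" if f: "f \<in> mor \<C> A' B'" for f
  proof -
    have fa: "f \<cdot> a \<in> mor \<C> A B'" using O f a by (blast intro: Comp_closed)
    then have "b' \<cdot> (f \<cdot> a) \<in> mor \<C> A B" using O b by (blast intro: Comp_closed)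
    then have z: "b' \<cdot> (f \<cdot> a) = \<one>\<^bsub>Hom \<C> A B\<^esub>" using t O trivial_Hom_iff by blast
    have "f \<cdot> a = b \<cdot> (b' \<cdot> (f \<cdot> a))"
      using Comp_assoc[OF O(1,4,2,4) fa b(2,1)] b(3) Comp_Ident_left[OF O(1,4) fa] by simp
    then have "f \<cdot> a = \<one>\<^bsub>Hom \<C> A B'\<^esub>" using z comp_zero_right[OF O(1,2,4) b(1)] by simp
    moreover have "f = f \<cdot> a \<cdot> a'"
      using Comp_assoc[OF O(3,1,3,4) a(2,1) f] a(3) Comp_Ident_right[OF O(3,4) f] by simp
    ultimately show ?thesis using comp_zero_left[OF O(3,1,4) a(2)] by simp
  qed
  then show ?thesis using trivial_Hom_iff[OF O(3,4)] by blast
qed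

end

section \<open>Values of a biadditive functor: zeros and invariance under isomorphism\<close>

context biadditive_functor
begin

lemma trivial_value_iff:
  assumes "C \<in> Obj \<C>" "A \<in> Obj \<C>"
  shows "trivial_group (G C A) \<longleftrightarrow> (\<forall>\<delta> \<in> carrier (G C A). \<delta> = \<one>\<^bsub>G C A\<^esub>)"
proof -
  interpret comm_group "G C A" using assms by (rule group_value)
  show ?thesis unfolding trivial_group_def using is_group one_closed by blast
qed

lemma map_closed:
  assumes "C \<in> Obj \<C>" "C' \<in> Obj \<C>" "A \<in> Obj \<C>" "A' \<in> Obj \<C>" "c \<in> mor \<C> C' C" "a \<in> mor \<C> A A'"
    "\<delta> \<in> carrier (G C A)"
  shows "F c a \<delta> \<in> carrier (G C' A')"
  using hom_in_carrier[OF map_hom[OF assms(1-6)] assms(7)] .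

lemma map_one:
  assumes "C \<in> Obj \<C>" "C' \<in> Obj \<C>" "A \<in> Obj \<C>" "A' \<in> Obj \<C>" "c \<in> mor \<C> C' C" "a \<in> mor \<C> A A'"
  shows "F c a \<one>\<^bsub>G C A\<^esub> = \<one>\<^bsub>G C' A'\<^esub>"
  using hom_one[OF map_hom[OF assms]] group_value[OF assms(1,3)] group_value[OF assms(2,4)]
  by (simp add: comm_group_def)

text \<open>By functoriality \<open>F a' b\<close> undoes \<open>F a b'\<close>, and
  \<open>F a b' \<delta>\<close> lies in the trivial group.\<close>

lemma trivial_value_iso:
  assumes O: "A \<in> Obj \<C>" "B \<in> Obj \<C>" "A' \<in> Obj \<C>" "B' \<in> Obj \<C>"
    and "isomorphic \<C> A A'" "isomorphic \<C> B B'" and t: "trivial_group (G A B)"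
  shows "trivial_group (G A' B')"
proof -
  obtain a a' where a: "a \<in> mor \<C> A A'" "a' \<in> mor \<C> A' A" "a \<cdot> a' = Ident \<C> A'"
    using assms(5) by (rule isomorphicE)
  obtain b b' where b: "b \<in> mor \<C> B B'" "b' \<in> mor \<C> B' B" "b \<cdot> b' = Ident \<C> B'"
    using assms(6) by (rule isomorphicE)
  have "\<delta> = \<one>\<^bsub>G A' B'\<^esub>" if d: "\<delta> \<in> carrier (G A' B')" for \<delta>
  proof -
    have "F a b' \<delta> \<in> carrier (G A B)" using map_closed[OF O(3,1,4,2) a(1) b(2) d] .
    then have "F a b' \<delta> = \<one>\<^bsub>G A B\<^esub>" using t O trivial_value_iff by blast
    then have "F a' b (F a b' \<delta>) = \<one>\<^bsub>G A' B'\<^esub>" using map_one[OF O(1,3,2,4) a(2) b(1)] by simp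
    moreover have "F a' b (F a b' \<delta>) = \<delta>"
      using map_Comp[OF O(3,1,3,4,2,4) a(1,2) b(2,1) d] a(3) b(3) map_Ident[OF O(3,4) d] by simp
    ultimately show ?thesis by simp
  qed
  then show ?thesis using trivial_value_iff[OF O(3,4)] by blast
qed

end

section \<open>Cones of inflations\<close>

context extriangulated_category
begin

section \<open>Degenerate triangles and weak universal properties of a triangle\<close>

lemma E_triangleD:
  assumes "E_triangle \<C> A x B y C \<delta>"
  shows "A \<in> Obj \<C>" "B \<in> Obj \<C>" "C \<in> Obj \<C>" "x \<in> mor \<C> A B" "y \<in> mor \<C> B C"
    "\<delta> \<in> carrier (Ext \<C> C A)"
  using assms unfolding E_triangle_def by auto

text \<open>Supplies inflations with a prescribed cone, which carries statements about objects over
  to inflations.\<close>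

lemma triangle_from_zero:
  "\<lbrakk>is_zero_object \<C> Z; X \<in> Obj \<C>\<rbrakk> \<Longrightarrow>
    E_triangle \<C> Z \<one>\<^bsub>Hom \<C> Z X\<^esub> X (Ident \<C> X) X \<one>\<^bsub>Ext \<C> X Z\<^esub>"
  by (rule realization_zero[OF biproduct_zero_left])

lemma triangle_to_zero:
  "\<lbrakk>is_zero_object \<C> Z; X \<in> Obj \<C>\<rbrakk> \<Longrightarrow>
    E_triangle \<C> X (Ident \<C> X) X \<one>\<^bsub>Hom \<C> X Z\<^esub> Z \<one>\<^bsub>Ext \<C> Z X\<^esub>"
  by (rule realization_zero[OF biproduct_zero_right])

text \<open>Comparing \<open>A = A \<rightarrow> Z\<close> with the given triangle by
  \<open>ET3\<close>, with left map \<open>1\<close> and middle map \<open>x\<close>, factors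
  \<open>y \<cdot> x\<close> through a zero object.\<close>

lemma triangle_comp_zero:
  assumes t: "E_triangle \<C> A x B y C \<delta>"
  shows "y \<cdot> x = \<one>\<^bsub>Hom \<C> A C\<^esub>"
proof -
  note D = E_triangleD[OF t]
  obtain Z where Z: "is_zero_object \<C> Z" using ex_zero_object by blast
  then have Zo: "Z \<in> Obj \<C>" by (simp add: is_zero_object_def)
  obtain c where c: "c \<in> mor \<C> Z C" "c \<cdot> \<one>\<^bsub>Hom \<C> A Z\<^esub> = y \<cdot> x"
    using ET3[OF triangle_to_zero[OF Z D(1)] t Ident_closed[OF D(1)] D(4)] by auto
  then show ?thesis using comp_zero_right[OF D(1) Zo D(3) c(1)] by simp
qed

text \<open>A map \<open>k\<close> killed by \<open>y\<close> is the middle part of a morphism from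
  \<open>W = W \<rightarrow> Z\<close> to the triangle; \<open>ET3_op\<close> fills in its left
  component, which is the factor sought.\<close>

lemma triangle_weak_kernel:
  assumes t: "E_triangle \<C> A x B y C \<delta>" and W: "W \<in> Obj \<C>"
    and k: "k \<in> mor \<C> W B" "y \<cdot> k = \<one>\<^bsub>Hom \<C> W C\<^esub>"
  shows "\<exists>a \<in> mor \<C> W A. k = x \<cdot> a"
proof -
  note D = E_triangleD[OF t]
  obtain Z where Z: "is_zero_object \<C> Z" using ex_zero_object by blast
  then have Zo: "Z \<in> Obj \<C>" by (simp add: is_zero_object_def)
  have "\<one>\<^bsub>Hom \<C> Z C\<^esub> \<cdot> \<one>\<^bsub>Hom \<C> W Z\<^esub> = y \<cdot> k"
    using comp_zero_left[OF W Zo D(3) zero_closed[OF W Zo]] k(2) by simp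
  then obtain a where "a \<in> mor \<C> W A" "k \<cdot> Ident \<C> W = x \<cdot> a"
    using ET3_op[OF triangle_to_zero[OF Z W] t k(1) zero_closed[OF Zo D(3)]] by blast
  then show ?thesis using Comp_Ident_right[OF W D(2) k(1)] by auto
qed

text \<open>Dual comparison, from the triangle to \<open>Z \<rightarrow> W = W\<close>:
  \<open>ET3\<close> supplies the right component.\<close>

lemma triangle_weak_cokernel:
  assumes t: "E_triangle \<C> A x B y C \<delta>" and W: "W \<in> Obj \<C>"
    and k: "k \<in> mor \<C> B W" "k \<cdot> x = \<one>\<^bsub>Hom \<C> A W\<^esub>"
  shows "\<exists>a \<in> mor \<C> C W. k = a \<cdot> y"
proof -
  note D = E_triangleD[OF t]
  obtain Z where Z: "is_zero_object \<C> Z" using ex_zero_object by blast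
  then have Zo: "Z \<in> Obj \<C>" by (simp add: is_zero_object_def)
  have "k \<cdot> x = \<one>\<^bsub>Hom \<C> Z W\<^esub> \<cdot> \<one>\<^bsub>Hom \<C> A Z\<^esub>"
    using comp_zero_left[OF D(1) Zo W zero_closed[OF D(1) Zo]] k(2) by simp
  then obtain a where "a \<in> mor \<C> C W" "a \<cdot> y = Ident \<C> W \<cdot> k"
    using ET3[OF t triangle_from_zero[OF Z W] zero_closed[OF D(1) Zo] k(1)] by blast
  then show ?thesis using Comp_Ident_left[OF D(2) W k(1)] by auto
qed

text \<open>Since \<open>h\<close> pulls \<open>\<delta>\<close> back to zero, \<open>(1, h)\<close>
  is a morphism of extensions from \<open>0\<close> to \<open>\<delta>\<close>. It is realized by a
  map \<open>b\<close> out of the middle term of the split sequence, and \<open>b\<close> restricted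
  to \<open>W\<close> lifts \<open>h\<close>.\<close>

lemma triangle_lift:
  assumes t: "E_triangle \<C> A x B y C \<delta>" and W: "W \<in> Obj \<C>"
    and h: "h \<in> mor \<C> W C" "pull \<C> A h \<delta> = \<one>\<^bsub>Ext \<C> W A\<^esub>"
  shows "\<exists>k \<in> mor \<C> W B. h = y \<cdot> k"
proof -
  note D = E_triangleD[OF t]
  obtain S i j p q where S: "is_biproduct \<C> A W S i j p q" using biproducts[OF D(1) W] by blast
  then have j: "S \<in> Obj \<C>" "j \<in> mor \<C> W S" "q \<in> mor \<C> S W" "q \<cdot> j = Ident \<C> W"
    by (auto simp: is_biproduct_def)
  have "ext_morphism \<C> W A \<one>\<^bsub>Ext \<C> W A\<^esub> C A \<delta> (Ident \<C> A) h"
    unfolding ext_morphism_def push_def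
    using h D W by (simp add: Ident_closed map_one)
  then obtain b where b: "b \<in> mor \<C> S B" "y \<cdot> b = h \<cdot> q"
    using realization_morphism[OF realization_zero[OF S] t] by blast
  have "y \<cdot> (b \<cdot> j) = h"
    using Comp_assoc[OF W j(1) D(2,3) j(2) b(1) D(5)] Comp_assoc[OF W j(1) W D(3) j(2,3) h(1)]
      Comp_Ident_right[OF W D(3) h(1)] b j by simp
  moreover have "b \<cdot> j \<in> mor \<C> W B" using Comp_closed[OF W j(1) D(2) j(2) b(1)] .
  ultimately show ?thesis by auto
qed

text \<open>(ET3) over the identities of \<open>A\<close> and \<open>B\<close> compares the two cones in both directions. The
  comparison maps need not be inverse to each other; the defect factors through \<open>y'\<close>, which
  provides a corrected right inverse.\<close>

lemma cone_unique:
  assumes t: "E_triangle \<C> A x B y C \<delta>" and t': "E_triangle \<C> A x B y' C' \<delta>'"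
  shows "isomorphic \<C> C C'"
proof -
  note D = E_triangleD[OF t] and D' = E_triangleD[OF t']
  note IA = Ident_closed[OF D(1)] and IB = Ident_closed[OF D(2)]
  interpret EC: comm_group "Ext \<C> C' A" using D' by (intro group_value)
  interpret H: comm_group "Hom \<C> C' C'" using D' by (intro Hom_comm_group)
  have sq: "Ident \<C> B \<cdot> x = x \<cdot> Ident \<C> A"
    using Comp_Ident_left[OF D(1,2,4)] Comp_Ident_right[OF D(1,2,4)] by simp
  obtain c where c: "c \<in> mor \<C> C C'" "c \<cdot> y = y'" and cd: "\<delta> = pull \<C> A c \<delta>'"
    using ET3[OF t t' IA IB sq] Comp_Ident_right[OF D'(2,3,5)] map_Ident[OF D(3,1,6)]
    unfolding push_def by auto
  obtain g where g: "g \<in> mor \<C> C' C" and gd: "\<delta>' = pull \<C> A g \<delta>"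
    using ET3[OF t' t IA IB sq] map_Ident[OF D'(3,1,6)] unfolding push_def by auto
  \<comment> \<open>As \<open>\<delta>\<close> is the pullback of \<open>\<delta>'\<close> along
    \<open>c\<close>, pulling \<open>\<delta>'\<close> back along \<open>c \<cdot> h\<close> amounts
    to pulling \<open>\<delta>\<close> back along \<open>h\<close>.\<close>
  have pp: "pull \<C> A (c \<cdot> h) \<delta>' = pull \<C> A h \<delta>" if W: "W \<in> Obj \<C>" and h: "h \<in> mor \<C> W C" for W h
    using map_Comp[OF D'(3) D(3) W D(1,1,1) c(1) h IA IA D'(6)] cd
    by (simp add: pull_def Comp_Ident_left[OF D(1,1) IA])
  have cg: "c \<cdot> g \<in> mor \<C> C' C'" using Comp_closed[OF D'(3) D(3) D'(3) g c(1)] .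
  have I: "Ident \<C> C' \<in> mor \<C> C' C'" using Ident_closed[OF D'(3)] .
  let ?v = "inv\<^bsub>Hom \<C> C' C'\<^esub> (c \<cdot> g)"
  \<comment> \<open>The defect \<open>1 - c g\<close>. Since \<open>c \<cdot> g\<close> pulls
    \<open>\<delta>'\<close> back to itself, \<open>?d\<close> pulls it back to zero, so that
    \<open>triangle_lift\<close> applies.\<close>
  let ?d = "Ident \<C> C' \<otimes>\<^bsub>Hom \<C> C' C'\<^esub> ?v"
  have v: "?v \<in> mor \<C> C' C'" using cg by simp
  then have d: "?d \<in> mor \<C> C' C'" using I by simp
  note add = map_add_left[OF D'(3,3) D(1,1) _ _ IA D'(6)]
  have pd: "pull \<C> A (Ident \<C> C') \<delta>' = \<delta>'"
    using map_Ident[OF D'(3) D(1) D'(6)] by (simp add: pull_def)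
  have "?d \<otimes>\<^bsub>Hom \<C> C' C'\<^esub> (c \<cdot> g) = Ident \<C> C'"
    using I cg by (simp add: H.m_assoc)
  then have "pull \<C> A ?d \<delta>' \<otimes>\<^bsub>Ext \<C> C' A\<^esub> \<delta>' = \<delta>'"
    using add[OF d cg] pp[OF D'(3) g] gd pd by (simp add: pull_def)
  moreover have "pull \<C> A ?d \<delta>' \<in> carrier (Ext \<C> C' A)"
    unfolding pull_def using map_closed[OF D'(3,3) D(1,1) d IA D'(6)] .
  ultimately have "pull \<C> A ?d \<delta>' = \<one>\<^bsub>Ext \<C> C' A\<^esub>"
    using D'(6) by simp
  then obtain k where k: "k \<in> mor \<C> C' B" "?d = y' \<cdot> k"
    using triangle_lift[OF t' D'(3) d] by blast
  have yk: "y \<cdot> k \<in> mor \<C> C' C" using Comp_closed[OF D'(3) D(2,3) k(1) D(5)] .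
  \<comment> \<open>Adding \<open>y k\<close> to \<open>g\<close> repairs the defect:
    \<open>c (y k + g) = (1 - c g) + c g = 1\<close>.\<close>
  have "c \<cdot> (y \<cdot> k) = ?d"
    using Comp_assoc[OF D'(3) D(2,3) D'(3) k(1) D(5) c(1)] c k by simp
  then have "c \<cdot> (y \<cdot> k \<otimes>\<^bsub>Hom \<C> C' C\<^esub> g) = ?d \<otimes>\<^bsub>Hom \<C> C' C'\<^esub> (c \<cdot> g)"
    using Comp_add_right[OF D'(3) D(3) D'(3) yk g c(1)] by simp
  then have r: "c \<cdot> (y \<cdot> k \<otimes>\<^bsub>Hom \<C> C' C\<^esub> g) = Ident \<C> C'"
    using I cg by (simp add: H.m_assoc)
  have rc: "y \<cdot> k \<otimes>\<^bsub>Hom \<C> C' C\<^esub> g \<in> mor \<C> C' C"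
  proof -
    interpret comm_group "Hom \<C> C' C" using D D' by (intro Hom_comm_group)
    show ?thesis using yk g by simp
  qed
  show ?thesis
  proof (rule mono_split_epi_imp_isomorphic[OF D(3) D'(3) c(1) rc r])
    \<comment> \<open>From \<open>c h = 0\<close> it follows that \<open>h\<close> pulls
      \<open>\<delta>\<close> back to zero, so \<open>h = y m\<close>. Then
      \<open>y' m = c y m = 0\<close> gives \<open>m = x n\<close>, and \<open>h = y x n\<close>
      vanishes.\<close>
    fix h assume h: "h \<in> mor \<C> C C" "c \<cdot> h = \<one>\<^bsub>Hom \<C> C C'\<^esub>"
    interpret CA: comm_group "Ext \<C> C A" using D by (intro group_value)
    interpret CC': comm_group "Hom \<C> C C'" using D D' by (intro Hom_comm_group)
    have "pull \<C> A \<one>\<^bsub>Hom \<C> C C'\<^esub> \<delta>' = \<one>\<^bsub>Ext \<C> C A\<^esub>"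
      using map_add_left[OF D'(3) D(3,1,1) CC'.one_closed CC'.one_closed IA D'(6)]
        map_closed[OF D'(3) D(3,1,1) CC'.one_closed IA D'(6)]
      by (simp add: pull_def)
    then have "pull \<C> A h \<delta> = \<one>\<^bsub>Ext \<C> C A\<^esub>" using pp[OF D(3) h(1)] h(2) by simp
    then obtain m where m: "m \<in> mor \<C> C B" "h = y \<cdot> m"
      using triangle_lift[OF t D(3) h(1)] by blast
    have "y' \<cdot> m = \<one>\<^bsub>Hom \<C> C C'\<^esub>"
      using Comp_assoc[OF D(3,2,3) D'(3) m(1) D(5) c(1)] c m h by simp
    then obtain n where n: "n \<in> mor \<C> C A" "m = x \<cdot> n"
      using triangle_weak_kernel[OF t' D(3) m(1)] by blast
    have "h = y \<cdot> x \<cdot> n" using m n Comp_assoc[OF D(3,1,2,3) n(1) D(4,5)] by simp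
    then show "h = \<one>\<^bsub>Hom \<C> C C\<^esub>"
      using triangle_comp_zero[OF t] comp_zero_left[OF D(3,1,3) n(1)] by simp
  qed
qed

section \<open>The chosen cone of an inflation, and passing between objects and inflations\<close>

lemma inflation_triangle:
  assumes "inflation \<C> x"
  obtains A B y \<delta> where "E_triangle \<C> A x B y (cone \<C> x) \<delta>"
proof -
  have "\<exists>C A B y \<delta>. E_triangle \<C> A x B y C \<delta>" using assms unfolding inflation_def by blast
  from someI_ex[OF this] show ?thesis unfolding cone_def[symmetric] using that by blast
qed

text \<open>Links the choice made in \<open>cone\<close> to any triangle at hand: a morphism
  determines its source and target, so the chosen triangle also starts with
  \<open>A \<rightarrow> B\<close> and \<open>cone_unique\<close> applies.\<close>

lemma E_triangle_cone:
  assumes t: "E_triangle \<C> A x B y C \<delta>"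
  shows "inflation \<C> x" "isomorphic \<C> C (cone \<C> x)" "cone \<C> x \<in> Obj \<C>"
proof -
  show i: "inflation \<C> x" using t unfolding inflation_def by blast
  obtain A' B' y' \<delta>' where t': "E_triangle \<C> A' x B' y' (cone \<C> x) \<delta>'"
    using i by (rule inflation_triangle)
  have "A' = A" "B' = B"
    using Dom_Cod[OF E_triangleD(1,2,4)[OF t]] Dom_Cod[OF E_triangleD(1,2,4)[OF t']] by auto
  with t t' show "isomorphic \<C> C (cone \<C> x)" using cone_unique by blast
  show "cone \<C> x \<in> Obj \<C>" using E_triangleD(3)[OF t'] .
qed

lemma cone_in_Obj: "inflation \<C> x \<Longrightarrow> cone \<C> x \<in> Obj \<C>"
  unfolding inflation_def using E_triangle_cone(3) by blast

lemma ex_inflation_cone: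
  assumes "X \<in> Obj \<C>"
  shows "\<exists>f. inflation \<C> f \<and> isomorphic \<C> X (cone \<C> f)"
  using ex_zero_object triangle_from_zero[OF _ assms] E_triangle_cone by blast

text \<open>\<open>Infl\<close> tests the chosen cone; as \<open>\<U>\<close> is closed under
  isomorphisms, any other cone of \<open>x\<close> may be tested instead.\<close>

lemma in_Infl_iff:
  assumes U: "subcategory \<C> \<U>" and t: "E_triangle \<C> A x B y C \<delta>"
  shows "x \<in> Infl \<C> \<U> \<longleftrightarrow> C \<in> \<U>"
  using U E_triangle_cone[OF t] E_triangleD(3)[OF t] isomorphic_sym
  unfolding Infl_def subcategory_def by blast

text \<open>One inclusion is closure of \<open>\<U>\<close> under isomorphisms. The other needs
  enough inflations: each \<open>X\<close> in \<open>\<U>\<close> is a cone up to isomorphism, and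
  that cone again lies in \<open>\<U>\<close>.\<close>

lemma Cone_Infl:
  assumes U: "subcategory \<C> \<U>"
  shows "Cone \<C> (Infl \<C> \<U>) = \<U>"
proof
  show "Cone \<C> (Infl \<C> \<U>) \<subseteq> \<U>"
    using U isomorphic_sym unfolding Cone_def Infl_def subcategory_def by blast
  show "\<U> \<subseteq> Cone \<C> (Infl \<C> \<U>)"
  proof
    fix X assume X: "X \<in> \<U>"
    then have Xo: "X \<in> Obj \<C>" using U unfolding subcategory_def by blast
    obtain f where f: "inflation \<C> f" "isomorphic \<C> X (cone \<C> f)" using ex_inflation_cone[OF Xo] by blast
    then have "cone \<C> f \<in> \<U>" using U X cone_in_Obj unfolding subcategory_def by blast
    then show "X \<in> Cone \<C> (Infl \<C> \<U>)" using f Xo unfolding Cone_def Infl_def by blast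
  qed
qed

lemma subcategory_Cone:
  assumes "\<I> \<subseteq> Collect (inflation \<C>)"
  shows "subcategory \<C> (Cone \<C> \<I>)"
  unfolding subcategory_def
proof (intro conjI ballI impI)
  show "Cone \<C> \<I> \<subseteq> Obj \<C>" unfolding Cone_def by blast
  fix X Y assume X: "X \<in> Cone \<C> \<I>" and Y: "Y \<in> Obj \<C>" and i: "isomorphic \<C> X Y"
  then obtain f where f: "X \<in> Obj \<C>" "f \<in> \<I>" "isomorphic \<C> X (cone \<C> f)"
    unfolding Cone_def by blast
  then have "isomorphic \<C> Y (cone \<C> f)"
    using isomorphic_trans[OF Y f(1) cone_in_Obj isomorphic_sym[OF i]] assms by blast
  then show "Y \<in> Cone \<C> \<I>" using f Y unfolding Cone_def by blast
qed

end

section \<open>Torsion pairs and orthogonality\<close>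

context neg_extriangulated_category
begin

text \<open>An inflation need not be a monomorphism. By exactness at \<open>Hom \<C> W A\<close>, a
  map killed by \<open>x\<close> comes from \<open>NegExt \<C> W C\<close> under the connecting map,
  and that group is zero.\<close>

lemma inflation_cancel:
  assumes t: "E_triangle \<C> A x B y C \<delta>" and W: "W \<in> Obj \<C>"
    and triv: "trivial_group (NegExt \<C> W C)"
    and h: "h \<in> mor \<C> W A" "x \<cdot> h = \<one>\<^bsub>Hom \<C> W B\<^esub>"
  shows "h = \<one>\<^bsub>Hom \<C> W A\<^esub>"
proof -
  note D = E_triangleD[OF t]
  have "h \<in> SharpLeft \<C> C A \<delta> W ` carrier (NegExt \<C> W C)"
    using exact_left[OF t W] h unfolding exact_at_def kernel_def by blast
  then have "h = SharpLeft \<C> C A \<delta> W \<one>\<^bsub>NegExt \<C> W C\<^esub>"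
    using triv neg.trivial_value_iff[OF W D(3)] by auto
  then show ?thesis
    using hom_one[OF SharpLeft_hom[OF D(1,3) W D(6)]] neg.group_value[OF W D(3)] Hom_comm_group[OF W D(1)]
    by (simp add: comm_group_def)
qed

text \<open>Dually, by exactness at \<open>Hom \<C> C W\<close>, a map killed by \<open>y\<close>
  comes from \<open>NegExt \<C> A W\<close>.\<close>

lemma deflation_cancel:
  assumes t: "E_triangle \<C> A x B y C \<delta>" and W: "W \<in> Obj \<C>"
    and triv: "trivial_group (NegExt \<C> A W)"
    and h: "h \<in> mor \<C> C W" "h \<cdot> y = \<one>\<^bsub>Hom \<C> B W\<^esub>"
  shows "h = \<one>\<^bsub>Hom \<C> C W\<^esub>"
proof -
  note D = E_triangleD[OF t]
  have "h \<in> SharpRight \<C> C A \<delta> W ` carrier (NegExt \<C> A W)"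
    using exact_right[OF t W] h unfolding exact_at_def kernel_def by blast
  then have "h = SharpRight \<C> C A \<delta> W \<one>\<^bsub>NegExt \<C> A W\<^esub>"
    using triv neg.trivial_value_iff[OF D(1) W] by auto
  then show ?thesis
    using hom_one[OF SharpRight_hom[OF D(1,3) W D(6)]] neg.group_value[OF D(1) W] Hom_comm_group[OF D(3) W]
    by (simp add: comm_group_def)
qed

section \<open>Each half of a torsion pair as the orthogonal of the other\<close>

lemma s_torsion_pairD:
  assumes "s_torsion_pair \<C> \<T> \<F>"
  shows "subcategory \<C> \<T>" "subcategory \<C> \<F>"
    "X \<in> Obj \<C> \<Longrightarrow> \<exists>T \<in> \<T>. \<exists>F \<in> \<F>. \<exists>x y \<delta>. E_triangle \<C> T x X y F \<delta>"
    "\<lbrakk>T \<in> \<T>; F \<in> \<F>\<rbrakk> \<Longrightarrow> trivial_group (Hom \<C> T F)"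
    "\<lbrakk>T \<in> \<T>; F \<in> \<F>\<rbrakk> \<Longrightarrow> trivial_group (NegExt \<C> T F)"
  using assms unfolding s_torsion_pair_def by blast+

text \<open>In the torsion triangle of \<open>X\<close> the map \<open>y\<close> is zero, so the
  identity of \<open>X\<close> lifts along \<open>x\<close>. As \<open>NegExt \<C> T F\<close>
  vanishes, \<open>x\<close> can be cancelled on endomorphisms of \<open>T\<close>; the split
  epimorphism \<open>x\<close> is then an isomorphism.\<close>

lemma torsion_if_Hom_trivial:
  assumes tp: "s_torsion_pair \<C> \<T> \<F>" and X: "X \<in> Obj \<C>"
    and triv: "\<And>F. F \<in> \<F> \<Longrightarrow> trivial_group (Hom \<C> X F)"
  shows "X \<in> \<T>"
proof -
  obtain T F x y \<delta> where T: "T \<in> \<T>" and F: "F \<in> \<F>" and t: "E_triangle \<C> T x X y F \<delta>"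
    using s_torsion_pairD(3)[OF tp X] by blast
  note D = E_triangleD[OF t]
  have "y = \<one>\<^bsub>Hom \<C> X F\<^esub>" using triv[OF F] D trivial_Hom_iff by blast
  then have "y \<cdot> Ident \<C> X = \<one>\<^bsub>Hom \<C> X F\<^esub>" using Comp_Ident_right[OF X D(3,5)] by simp
  then obtain a where a: "a \<in> mor \<C> X T" "x \<cdot> a = Ident \<C> X"
    using triangle_weak_kernel[OF t X Ident_closed[OF X]] by metis
  have "isomorphic \<C> T X"
    using mono_split_epi_imp_isomorphic[OF D(1,2,4) a]
      inflation_cancel[OF t D(1) s_torsion_pairD(5)[OF tp T F]] by blast
  then show ?thesis using s_torsion_pairD(1)[OF tp] T X unfolding subcategory_def by blast
qed

text \<open>Dually, \<open>x\<close> is zero, so the identity of \<open>X\<close> extends along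
  \<open>y\<close>, and the split monomorphism \<open>y\<close> is an isomorphism by cancellation on
  endomorphisms of \<open>F\<close>.\<close>

lemma torsion_free_if_Hom_trivial:
  assumes tp: "s_torsion_pair \<C> \<T> \<F>" and X: "X \<in> Obj \<C>"
    and triv: "\<And>T. T \<in> \<T> \<Longrightarrow> trivial_group (Hom \<C> T X)"
  shows "X \<in> \<F>"
proof -
  obtain T F x y \<delta> where T: "T \<in> \<T>" and F: "F \<in> \<F>" and t: "E_triangle \<C> T x X y F \<delta>"
    using s_torsion_pairD(3)[OF tp X] by blast
  note D = E_triangleD[OF t]
  have "x = \<one>\<^bsub>Hom \<C> T X\<^esub>" using triv[OF T] D trivial_Hom_iff by blast
  then have "Ident \<C> X \<cdot> x = \<one>\<^bsub>Hom \<C> T X\<^esub>" using Comp_Ident_left[OF D(1) X D(4)] by simp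
  then obtain a where a: "a \<in> mor \<C> F X" "a \<cdot> y = Ident \<C> X"
    using triangle_weak_cokernel[OF t X Ident_closed[OF X]] by metis
  have "isomorphic \<C> X F"
    using epi_split_mono_imp_isomorphic[OF D(2,3,5) a]
      deflation_cancel[OF t D(3) s_torsion_pairD(5)[OF tp T F]] by blast
  then show ?thesis
    using s_torsion_pairD(2)[OF tp] F X isomorphic_sym unfolding subcategory_def by blast
qed

section \<open>From torsion pairs to inflation factorization systems\<close>

lemma infl_orth_iso:
  assumes i: "inflation \<C> l" "inflation \<C> r" "inflation \<C> l'" "inflation \<C> r'"
    and iso: "isomorphic \<C> (cone \<C> l) (cone \<C> l')" "isomorphic \<C> (cone \<C> r) (cone \<C> r')"
    and o: "infl_orth \<C> l r"
  shows "infl_orth \<C> l' r'"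
  using trivial_Hom_iso[OF i[THEN cone_in_Obj] iso] neg.trivial_value_iso[OF i[THEN cone_in_Obj] iso] o
  unfolding infl_orth_def by blast

lemma Infl_factorization:
  assumes tp: "s_torsion_pair \<C> \<T> \<F>" and f: "inflation \<C> f"
  shows "\<exists>l \<in> Infl \<C> \<T>. \<exists>r \<in> Infl \<C> \<F>. Cod \<C> l = Dom \<C> r \<and> f = r \<cdot> l"
proof -
  obtain A B y \<delta> where t: "E_triangle \<C> A f B y (cone \<C> f) \<delta>" using f by (rule inflation_triangle)
  obtain T F u v \<epsilon> where T: "T \<in> \<T>" and F: "F \<in> \<F>" and s: "E_triangle \<C> T u (cone \<C> f) v F \<epsilon>"
    using s_torsion_pairD(3)[OF tp cone_in_Obj[OF f]] by blast
  \<comment> \<open>\<open>ET4_op\<close> composes the deflations \<open>y\<close> and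
    \<open>v\<close>. The cocone \<open>E\<close> of \<open>v \<cdot> y\<close> is the middle object
    of the factorization: \<open>r\<close> has cone \<open>F\<close>, and \<open>l\<close>, from the
    realization of the pullback of \<open>\<delta>\<close> along \<open>u\<close>, has cone
    \<open>T\<close>.\<close>
  obtain E r d l \<theta> where rl: "r \<cdot> l = f"
    and r: "E_triangle \<C> E r B (v \<cdot> y) F \<theta>"
    and l: "E_triangle \<C> A l E d T (pull \<C> A u \<delta>)"
    using ET4_op[OF s t] by blast
  have "Cod \<C> l = Dom \<C> r"
    using Dom_Cod[OF E_triangleD(1,2,4)[OF l]] Dom_Cod[OF E_triangleD(1,2,4)[OF r]] by simp
  moreover have "l \<in> Infl \<C> \<T>" using in_Infl_iff[OF s_torsion_pairD(1)[OF tp] l] T by simp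
  moreover have "r \<in> Infl \<C> \<F>" using in_Infl_iff[OF s_torsion_pairD(2)[OF tp] r] F by simp
  ultimately show ?thesis using rl by blast
qed

text \<open>Orthogonality of the two classes is the vanishing conditions read on cones. Conversely,
  an inflation orthogonal to one class has a cone that is \<open>Hom\<close>-orthogonal to one half
  of the pair, hence in the other half.\<close>

lemma Infl_factorization_system:
  assumes tp: "s_torsion_pair \<C> \<T> \<F>"
  shows "inflation_factorization_system \<C> (Infl \<C> \<T>) (Infl \<C> \<F>)"
proof -
  note sub = s_torsion_pairD(1,2)[OF tp]
  have orth: "infl_orth \<C> l r" if "l \<in> Infl \<C> \<T>" "r \<in> Infl \<C> \<F>" for l r
    using that s_torsion_pairD(4,5)[OF tp] unfolding Infl_def infl_orth_def by blast
  have L: "f \<in> Infl \<C> \<T>" if f: "f \<in> left_perp \<C> (Infl \<C> \<F>)" for f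
  proof -
    have i: "inflation \<C> f" and p: "\<And>g. g \<in> Infl \<C> \<F> \<Longrightarrow> infl_orth \<C> f g"
      using f unfolding left_perp_def by auto
    note fo = cone_in_Obj[OF i]
    have "trivial_group (Hom \<C> (cone \<C> f) Y)" if Y: "Y \<in> \<F>" for Y
    proof -
      \<comment> \<open>Orthogonality is known only against inflations, so \<open>Y\<close> is
        replaced by the cone of some \<open>g\<close>, which exists by
        \<open>Cone_Infl\<close>.\<close>
      obtain g where g: "Y \<in> Obj \<C>" "g \<in> Infl \<C> \<F>" "isomorphic \<C> Y (cone \<C> g)"
        using Y Cone_Infl[OF sub(2)] unfolding Cone_def by blast
      then have go: "cone \<C> g \<in> Obj \<C>" using cone_in_Obj unfolding Infl_def by blast
      show ?thesis
        using trivial_Hom_iso[OF fo go fo g(1) isomorphic_refl[OF fo] isomorphic_sym[OF g(3)]] p[OF g(2)]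
        unfolding infl_orth_def by blast
    qed
    then show ?thesis using torsion_if_Hom_trivial[OF tp fo] i unfolding Infl_def by blast
  qed
  have R: "f \<in> Infl \<C> \<F>" if f: "f \<in> right_perp \<C> (Infl \<C> \<T>)" for f
  proof -
    have i: "inflation \<C> f" and p: "\<And>g. g \<in> Infl \<C> \<T> \<Longrightarrow> infl_orth \<C> g f"
      using f unfolding right_perp_def by auto
    note fo = cone_in_Obj[OF i]
    have "trivial_group (Hom \<C> Y (cone \<C> f))" if Y: "Y \<in> \<T>" for Y
    proof -
      obtain g where g: "Y \<in> Obj \<C>" "g \<in> Infl \<C> \<T>" "isomorphic \<C> Y (cone \<C> g)"
        using Y Cone_Infl[OF sub(1)] unfolding Cone_def by blast
      then have go: "cone \<C> g \<in> Obj \<C>" using cone_in_Obj unfolding Infl_def by blast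
      show ?thesis
        using trivial_Hom_iso[OF go fo g(1) fo isomorphic_sym[OF g(3)] isomorphic_refl[OF fo]] p[OF g(2)]
        unfolding infl_orth_def by blast
    qed
    then show ?thesis using torsion_free_if_Hom_trivial[OF tp fo] i unfolding Infl_def by blast
  qed
  have "Infl \<C> \<T> = left_perp \<C> (Infl \<C> \<F>)"
    using L orth unfolding left_perp_def Infl_def by blast
  moreover have "right_perp \<C> (Infl \<C> \<T>) = Infl \<C> \<F>"
    using R orth unfolding right_perp_def Infl_def by blast
  moreover have "Infl \<C> \<U> \<subseteq> Collect (inflation \<C>)" for \<U> unfolding Infl_def by blast
  ultimately show ?thesis
    unfolding inflation_factorization_system_def using Infl_factorization[OF tp] by blast
qed

section \<open>From inflation factorization systems to torsion pairs\<close>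

lemma inflation_factorization_systemD:
  assumes "inflation_factorization_system \<C> \<L> \<R>"
  shows "\<L> \<subseteq> Collect (inflation \<C>)" "\<R> \<subseteq> Collect (inflation \<C>)"
    "inflation \<C> f \<Longrightarrow> \<exists>l \<in> \<L>. \<exists>r \<in> \<R>. Cod \<C> l = Dom \<C> r \<and> f = r \<cdot> l"
    "\<L> = left_perp \<C> \<R>" "right_perp \<C> \<L> = \<R>"
  using assms unfolding inflation_factorization_system_def by blast+

lemma Cone_s_torsion_pair:
  assumes fs: "inflation_factorization_system \<C> \<L> \<R>"
  shows "s_torsion_pair \<C> (Cone \<C> \<L>) (Cone \<C> \<R>)"
proof -
  note fsD = inflation_factorization_systemD[OF fs]
  have triv: "trivial_group (Hom \<C> T F) \<and> trivial_group (NegExt \<C> T F)"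
    if T: "T \<in> Cone \<C> \<L>" and F: "F \<in> Cone \<C> \<R>" for T F
  proof -
    obtain l where l: "T \<in> Obj \<C>" "l \<in> \<L>" "isomorphic \<C> (cone \<C> l) T"
      using T isomorphic_sym unfolding Cone_def by blast
    obtain r where r: "F \<in> Obj \<C>" "r \<in> \<R>" "isomorphic \<C> (cone \<C> r) F"
      using F isomorphic_sym unfolding Cone_def by blast
    have i: "inflation \<C> l" "inflation \<C> r" using l r fsD(1,2) by auto
    have "infl_orth \<C> l r" using l(2) r(2) fsD(4) unfolding left_perp_def by blast
    then show ?thesis
      using trivial_Hom_iso[OF i[THEN cone_in_Obj] l(1) r(1) l(3) r(3)]
        neg.trivial_value_iso[OF i[THEN cone_in_Obj] l(1) r(1) l(3) r(3)]
      unfolding infl_orth_def by blast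
  qed
  have tri: "\<exists>T \<in> Cone \<C> \<L>. \<exists>F \<in> Cone \<C> \<R>. \<exists>x y \<delta>. E_triangle \<C> T x X y F \<delta>"
    if X: "X \<in> Obj \<C>" for X
  proof -
    obtain Z where Z: "is_zero_object \<C> Z" using ex_zero_object by blast
    note t = triangle_from_zero[OF Z X]
    \<comment> \<open>The inflation being factored is \<open>0 \<rightarrow> X\<close>; the triangle
      of \<open>r\<close> will be the torsion triangle of \<open>X\<close>.\<close>
    obtain l r where lr: "l \<in> \<L>" "r \<in> \<R>" "Cod \<C> l = Dom \<C> r" "\<one>\<^bsub>Hom \<C> Z X\<^esub> = r \<cdot> l"
      using fsD(3)[OF E_triangle_cone(1)[OF t]] by blast
    have il: "inflation \<C> l" and ir: "inflation \<C> r" using lr fsD(1,2) by auto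
    obtain A E d \<delta> where l: "E_triangle \<C> A l E d (cone \<C> l) \<delta>" using il by (rule inflation_triangle)
    obtain E' B e \<epsilon> where r: "E_triangle \<C> E' r B e (cone \<C> r) \<epsilon>" using ir by (rule inflation_triangle)
    note Dl = E_triangleD[OF l] and Dr = E_triangleD[OF r] and Dt = E_triangleD[OF t]
    \<comment> \<open>Sources and targets are read off the morphisms: \<open>E'\<close> is
      \<open>E\<close>, and then \<open>A\<close> is the zero object \<open>Z\<close> and
      \<open>B\<close> is \<open>X\<close>.\<close>
    have E: "E' = E" using lr(3) Dom_Cod[OF Dl(1,2,4)] Dom_Cod[OF Dr(1,2,4)] by simp
    have "r \<cdot> l \<in> mor \<C> A B" using Comp_closed[OF Dl(1,2) Dr(2) Dl(4)] Dr(4) E by simp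
    then have AB: "A = Z" "B = X"
      using Dom_Cod[OF Dl(1) Dr(2)] Dom_Cod[OF Dt(1,2,4)] lr(4) by auto
    \<comment> \<open>Leaving a zero object, \<open>l\<close> must be the canonical map
      \<open>0 \<rightarrow> E\<close>, whose cone is \<open>E\<close> itself.\<close>
    have "l = \<one>\<^bsub>Hom \<C> Z E\<^esub>"
      using from_zero_object[OF Z Dl(2)] Dl(4) zero_closed[OF Dt(1) Dl(2)] AB by blast
    then have "isomorphic \<C> E (cone \<C> l)"
      using E_triangle_cone(2)[OF triangle_from_zero[OF Z Dl(2)]] by simp
    then have "E \<in> Cone \<C> \<L>" using lr(1) Dl(2) unfolding Cone_def by blast
    moreover have "cone \<C> r \<in> Cone \<C> \<R>"
      using lr(2) isomorphic_refl[OF Dr(3)] Dr(3) unfolding Cone_def by blast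
    ultimately show ?thesis using r E AB by blast
  qed
  show ?thesis
    unfolding s_torsion_pair_def
    using subcategory_Cone[OF fsD(1)] subcategory_Cone[OF fsD(2)] triv tri by blast
qed

text \<open>Orthogonality depends only on cones up to isomorphism, so an inflation sharing its cone
  with a member of the class is a member too. With \<open>\<L> = left_perp \<C> \<R>\<close> this
  shows that \<open>\<L>\<close> is recovered from its cones.\<close>

lemma Infl_Cone_left_perp:
  assumes R: "\<R> \<subseteq> Collect (inflation \<C>)"
  shows "Infl \<C> (Cone \<C> (left_perp \<C> \<R>)) = left_perp \<C> \<R>"
proof
  show "left_perp \<C> \<R> \<subseteq> Infl \<C> (Cone \<C> (left_perp \<C> \<R>))"
    using cone_in_Obj isomorphic_refl unfolding Infl_def Cone_def left_perp_def by blast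
  show "Infl \<C> (Cone \<C> (left_perp \<C> \<R>)) \<subseteq> left_perp \<C> \<R>"
  proof
    fix f assume "f \<in> Infl \<C> (Cone \<C> (left_perp \<C> \<R>))"
    then obtain g where f: "inflation \<C> f"
      and g: "g \<in> left_perp \<C> \<R>" "isomorphic \<C> (cone \<C> g) (cone \<C> f)"
      using isomorphic_sym unfolding Infl_def Cone_def by blast
    have gi: "inflation \<C> g" using g unfolding left_perp_def by blast
    have "infl_orth \<C> f r" if r: "r \<in> \<R>" for r
    proof -
      have ri: "inflation \<C> r" using r R by blast
      have "infl_orth \<C> g r" using g(1) r unfolding left_perp_def by blast
      then show ?thesis
        using infl_orth_iso[OF gi ri f ri g(2) isomorphic_refl[OF cone_in_Obj[OF ri]]] by blast
    qed
    then show "f \<in> left_perp \<C> \<R>" using f unfolding left_perp_def by blast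
  qed
qed

text \<open>The same argument in the second variable; it recovers \<open>\<R>\<close> from its
  cones.\<close>

lemma Infl_Cone_right_perp:
  assumes L: "\<L> \<subseteq> Collect (inflation \<C>)"
  shows "Infl \<C> (Cone \<C> (right_perp \<C> \<L>)) = right_perp \<C> \<L>"
proof
  show "right_perp \<C> \<L> \<subseteq> Infl \<C> (Cone \<C> (right_perp \<C> \<L>))"
    using cone_in_Obj isomorphic_refl unfolding Infl_def Cone_def right_perp_def by blast
  show "Infl \<C> (Cone \<C> (right_perp \<C> \<L>)) \<subseteq> right_perp \<C> \<L>"
  proof
    fix f assume "f \<in> Infl \<C> (Cone \<C> (right_perp \<C> \<L>))"
    then obtain g where f: "inflation \<C> f"
      and g: "g \<in> right_perp \<C> \<L>" "isomorphic \<C> (cone \<C> g) (cone \<C> f)"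
      using isomorphic_sym unfolding Infl_def Cone_def by blast
    have gi: "inflation \<C> g" using g unfolding right_perp_def by blast
    have "infl_orth \<C> l f" if l: "l \<in> \<L>" for l
    proof -
      have li: "inflation \<C> l" using l L by blast
      have "infl_orth \<C> l g" using g(1) l unfolding right_perp_def by blast
      then show ?thesis
        using infl_orth_iso[OF li gi li f isomorphic_refl[OF cone_in_Obj[OF li]] g(2)] by blast
    qed
    then show "f \<in> right_perp \<C> \<L>" using f unfolding right_perp_def by blast
  qed
qed

end

section \<open>The two assignments invert each other\<close>

theorem theorem3p1:
  fixes \<C> :: "('o, 'm, 'e, 'n, 'z) neg_extriangulated_data_scheme"
  assumes "neg_extriangulated_category \<C>"
  shows "mutually_inverse_bijections
    (\<lambda>(\<T>, \<F>). (Infl \<C> \<T>, Infl \<C> \<F>))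
    (\<lambda>(\<L>, \<R>). (Cone \<C> \<L>, Cone \<C> \<R>))
    {(\<T>, \<F>). s_torsion_pair \<C> \<T> \<F>}
    {(\<L>, \<R>). inflation_factorization_system \<C> \<L> \<R>}"
proof -
  interpret neg_extriangulated_category \<C> by (rule assms)
  let ?\<Phi> = "\<lambda>(\<T>, \<F>). (Infl \<C> \<T>, Infl \<C> \<F>)"
  let ?\<Psi> = "\<lambda>(\<L>, \<R>). (Cone \<C> \<L>, Cone \<C> \<R>)"
  let ?X = "{(\<T>, \<F>). s_torsion_pair \<C> \<T> \<F>}"
  let ?Y = "{(\<L>, \<R>). inflation_factorization_system \<C> \<L> \<R>}"
  have inv1: "\<forall>x \<in> ?X. ?\<Psi> (?\<Phi> x) = x"
    using s_torsion_pairD(1,2) Cone_Infl by auto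
  have inv2: "\<forall>y \<in> ?Y. ?\<Phi> (?\<Psi> y) = y"
  proof clarsimp
    fix \<L> \<R> assume "inflation_factorization_system \<C> \<L> \<R>"
    note fsD = inflation_factorization_systemD[OF this]
    \<comment> \<open>Each of the two classes is the orthogonal of the other, and orthogonal classes
      are recovered from their cones.\<close>
    show "Infl \<C> (Cone \<C> \<L>) = \<L> \<and> Infl \<C> (Cone \<C> \<R>) = \<R>"
      using Infl_Cone_left_perp[OF fsD(2)] Infl_Cone_right_perp[OF fsD(1)] fsD(4,5) by metis
  qed
  have im: "?\<Phi> ` ?X \<subseteq> ?Y" "?\<Psi> ` ?Y \<subseteq> ?X"
    using Infl_factorization_system Cone_s_torsion_pair by auto
  show ?thesis
    unfolding mutually_inverse_bijections_def
    using bij_betw_byWitness[OF inv1 inv2 im] bij_betw_byWitness[OF inv2 inv1 im(2,1)] inv1 inv2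
    by blast
qed

end
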